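(* Let $G$ be a group acting by isometries on a hyperbolic space $\mathbb X$, and let $H$ be an $\alpha$-rotating subgroup of $G$ with respect to this action for some $\alpha\ge200$. Let $\langle\langle H\rangle\rangle^G$ denote the normal closure of $H$ in $G$. Then the following hold. (a) There exists a (usually infinite) subset $T\subseteq G$ such that $\langle\langle H\rangle\rangle^G=\ast_{t\in T}\,t^{-1}Ht$ (that is, $\langle\langle H\rangle\rangle^G$ is the free product of its subgroups $t^{-1}Ht$, $t\in T$). (b) Every element $h\in\langle\langle H\rangle\rangle^G$ either is conjugate to an element of $H$, or is loxodromic with respect to the action on $\mathbb X$.
   Context: A geodesic metric space $(\mathbb X,d)$ is $\delta$-hyperbolic if for any geodesic triangle with vertices $x,y,z$ and any points $p\in[x,y]$, $q\in[x,z]$ with $d(x,p)=d(x,q)\le (y|z)_x:=\frac12(d(x,y)+d(x,z)-d(y,z))$ one has $d(p,q)\le\delta$; it is hyperbolic if this holds for some $\delta\ge 0$. An element $g\in G$ is loxodromic if $n\mapsto g^n(s)$ is a quasi-isometric embedding $\mathbb Z\to\mathbb X$ for some (equivalently, any) $s\in\mathbb X$. Rotating families. Let $G$ act on a metric space $\mathbb X$. A rotating family $\mathcal C=(C,\{G_c\}_{c\in C})$ consists of a subset $C\subset\mathbb X$ (the apices) and a collection $\{G_c\mid c\in C\}$ of subgroups of $G$ (the rotation subgroups) such that $C$ is $G$-invariant, each $G_c$ fixes $c$, and $G_{gc}=gG_cg^{-1}$ for all $g\in G$, $c\in C$. It is $\rho$-separated if any two distinct apices are at distance at least $\rho$. If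 $\mathbb X$ is $\delta$-hyperbolic with $\delta>0$, $\mathcal C$ is very rotating if for all $c\in C$, $g\in G_c\setminus\{1\}$ and all $x,y\in\mathbb X$ with $d(x,c),d(y,c)\in[20\delta,40\delta]$ and $d(gx,y)\le15\delta$, any geodesic between $x$ and $y$ contains $c$. A subgroup $H\le G$ is $\alpha$-rotating with respect to the action of $G$ on $\mathbb X$ if, for some $\delta>0$ such that $\mathbb X$ is $\delta$-hyperbolic, there is an $\alpha\delta$-separated very rotating family for $G$ acting on $\mathbb X$ whose rotation subgroups are exactly the conjugates of $H$ in $G$. *)

theory Defs
  imports "HOL-Analysis.Analysis" "HOL-Algebra.Group_Action"
begin

section \<open>Geodesic and hyperbolic metric spaces\<close>

definition geodesic_between :: "'x::metric_space \<Rightarrow> 'x \<Rightarrow> 'x set \<Rightarrow> bool" where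
  "geodesic_between x y S \<longleftrightarrow>
     (\<exists>\<gamma> :: real \<Rightarrow> 'x. \<gamma> 0 = x \<and> \<gamma> (dist x y) = y \<and> S = \<gamma> ` {0..dist x y} \<and>
        (\<forall>s\<in>{0..dist x y}. \<forall>t\<in>{0..dist x y}. dist (\<gamma> s) (\<gamma> t) = \<bar>s - t\<bar>))"

text \<open>The space is the whole type; properties of it take a type argument.\<close>

definition geodesic_space :: "'x::metric_space itself \<Rightarrow> bool" where
  "geodesic_space _ \<longleftrightarrow> (\<forall>x y :: 'x. \<exists>S. geodesic_between x y S)"

definition gromov_product :: "'x::metric_space \<Rightarrow> 'x \<Rightarrow> 'x \<Rightarrow> real" where
  \<comment> \<open>base point last: \<^term>\<open>gromov_product y z x\<close> is \<open>(y|z)\<^sub>x\<close>\<close>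
  "gromov_product y z x = (dist x y + dist x z - dist y z) / 2"

definition delta_hyperbolic :: "real \<Rightarrow> 'x::metric_space itself \<Rightarrow> bool" where
  "delta_hyperbolic \<delta> (_ :: 'x itself) \<longleftrightarrow> geodesic_space TYPE('x) \<and>
     (\<forall>(x::'x) y z Sxy Sxz Syz.
        geodesic_between x y Sxy \<and> geodesic_between x z Sxz \<and> geodesic_between y z Syz \<longrightarrow>
        (\<forall>p\<in>Sxy. \<forall>q\<in>Sxz.
           dist x p = dist x q \<and> dist x q \<le> gromov_product y z x \<longrightarrow> dist p q \<le> \<delta>))"

definition hyperbolic :: "'x::metric_space itself \<Rightarrow> bool" where
  "hyperbolic (_ :: 'x itself) \<longleftrightarrow> (\<exists>\<delta>\<ge>0. delta_hyperbolic \<delta> TYPE('x))"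


section \<open>Isometric actions and loxodromic elements\<close>

locale isometric_action = group_action G UNIV \<phi>
  for G :: "('g, 'b) monoid_scheme" (structure)
    and \<phi> :: "'g \<Rightarrow> 'x::metric_space \<Rightarrow> 'x" +
  assumes isometric: "g \<in> carrier G \<Longrightarrow> dist (\<phi> g x) (\<phi> g y) = dist x y"

definition quasi_isometric_embedding_int :: "(int \<Rightarrow> 'x::metric_space) \<Rightarrow> bool" where
  \<comment> \<open>the domain carries the metric \<open>\<bar>m - n\<bar>\<close>\<close>
  "quasi_isometric_embedding_int f \<longleftrightarrow>
     (\<exists>K::real. \<exists>L::real. K \<ge> 1 \<and> L \<ge> 0 \<and>
        (\<forall>m n. real_of_int \<bar>m - n\<bar> / K - L \<le> dist (f m) (f n) \<and>
               dist (f m) (f n) \<le> K * real_of_int \<bar>m - n\<bar> + L))"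

definition loxodromic ::
    "('g, 'b) monoid_scheme \<Rightarrow> ('g \<Rightarrow> 'x::metric_space \<Rightarrow> 'x) \<Rightarrow> 'g \<Rightarrow> bool" where
  "loxodromic G \<phi> g \<longleftrightarrow>
     g \<in> carrier G \<and>
     (\<exists>s. quasi_isometric_embedding_int (\<lambda>n::int. \<phi> (g [^]\<^bsub>G\<^esub> n) s))"


section \<open>Conjugates, normal closure, free products\<close>

definition conj_set :: "('g, 'b) monoid_scheme \<Rightarrow> 'g \<Rightarrow> 'g set \<Rightarrow> 'g set" where
  "conj_set G g H = g <#\<^bsub>G\<^esub> H #>\<^bsub>G\<^esub> inv\<^bsub>G\<^esub> g"

definition normal_closure :: "('g, 'b) monoid_scheme \<Rightarrow> 'g set \<Rightarrow> 'g set" where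
  "normal_closure G H = (\<lambda>N. N \<lhd> G) hull H"

text \<open>
  A word in the factors \<open>K i\<close> is a list of pairs \<open>(i, x)\<close>. Letters carry their index, so that
  factors with different indices count as different even if they are equal as subsets.
\<close>

definition reduced_words ::
    "('g, 'b) monoid_scheme \<Rightarrow> 'i set \<Rightarrow> ('i \<Rightarrow> 'g set) \<Rightarrow> ('i \<times> 'g) list set" where
  "reduced_words P I K =
     {w. (\<forall>(i, x)\<in>set w. i \<in> I \<and> x \<in> K i - {\<one>\<^bsub>P\<^esub>}) \<and> distinct_adj (map fst w)}"

definition word_value :: "('g, 'b) monoid_scheme \<Rightarrow> ('i \<times> 'g) list \<Rightarrow> 'g" where
  "word_value P w = foldr (\<lambda>(i, x) y. x \<otimes>\<^bsub>P\<^esub> y) w \<one>\<^bsub>P\<^esub>"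

text \<open>
  \<open>P\<close> is the (internal) free product of its subgroups \<open>K i\<close>, \<open>i \<in> I\<close>: every element
  of \<open>P\<close> is the value of exactly one reduced word.
\<close>

definition is_free_product ::
    "('g, 'b) monoid_scheme \<Rightarrow> 'i set \<Rightarrow> ('i \<Rightarrow> 'g set) \<Rightarrow> bool" where
  "is_free_product P I K \<longleftrightarrow>
     group P \<and> (\<forall>i\<in>I. subgroup (K i) P) \<and>
     bij_betw (word_value P) (reduced_words P I K) (carrier P)"


section \<open>Rotating families\<close>

definition rotating_family ::
    "('g, 'b) monoid_scheme \<Rightarrow> ('g \<Rightarrow> 'x \<Rightarrow> 'x) \<Rightarrow> 'x set \<Rightarrow> ('x \<Rightarrow> 'g set) \<Rightarrow> bool" where
  "rotating_family G \<phi> C R \<longleftrightarrow>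
     (\<forall>g\<in>carrier G. \<phi> g ` C = C) \<and>
     (\<forall>c\<in>C. subgroup (R c) G) \<and>
     (\<forall>c\<in>C. \<forall>g\<in>R c. \<phi> g c = c) \<and>
     (\<forall>g\<in>carrier G. \<forall>c\<in>C. R (\<phi> g c) = conj_set G g (R c))"

definition separated :: "real \<Rightarrow> 'x::metric_space set \<Rightarrow> bool" where
  "separated \<rho> C \<longleftrightarrow> (\<forall>c\<in>C. \<forall>c'\<in>C. c \<noteq> c' \<longrightarrow> dist c c' \<ge> \<rho>)"

definition very_rotating ::
    "('g, 'b) monoid_scheme \<Rightarrow> ('g \<Rightarrow> 'x::metric_space \<Rightarrow> 'x) \<Rightarrow> real \<Rightarrow>
     'x set \<Rightarrow> ('x \<Rightarrow> 'g set) \<Rightarrow> bool" where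
  "very_rotating G \<phi> \<delta> C R \<longleftrightarrow>
     (\<forall>c\<in>C. \<forall>g\<in>R c - {\<one>\<^bsub>G\<^esub>}. \<forall>x y.
        dist x c \<in> {20*\<delta>..40*\<delta>} \<and> dist y c \<in> {20*\<delta>..40*\<delta>} \<and> dist (\<phi> g x) y \<le> 15*\<delta> \<longrightarrow>
        (\<forall>S. geodesic_between x y S \<longrightarrow> c \<in> S))"

definition alpha_rotating ::
    "('g, 'b) monoid_scheme \<Rightarrow> ('g \<Rightarrow> 'x::metric_space \<Rightarrow> 'x) \<Rightarrow> real \<Rightarrow> 'g set \<Rightarrow> bool" where
  "alpha_rotating G \<phi> \<alpha> H \<longleftrightarrow>
     subgroup H G \<and>
     (\<exists>\<delta>>0. delta_hyperbolic \<delta> TYPE('x) \<and>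
        (\<exists>C R. rotating_family G \<phi> C R \<and> separated (\<alpha> * \<delta>) C \<and> very_rotating G \<phi> \<delta> C R \<and>
               R ` C = {conj_set G g H | g. g \<in> carrier G}))"

end

theory Submission
  imports Defs "HOL-Algebra.Generated_Groups"
begin

text \<open>
  This is the windmill argument of Dahmani, Guirardel and Osin, carried out with sets of apices and
  Gromov products instead of quasiconvex subsets of the space. A windmill is a set \<open>A\<close> of apices,
  invariant under the group \<open>gen A\<close> generated by its rotations, such that \<open>(a|b)\<^sub>c \<ge> 40\<delta>\<close> for
  \<open>a, b \<in> A\<close> and every other apex \<open>c\<close>, and such that both claims hold for \<open>gen A\<close>. If some apex is
  missing, let the front consist of the apices outside \<open>A\<close> that are closest to \<open>A\<close> up to \<open>20\<delta>\<close>. Seen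
  from an apex of the front, \<open>A\<close> and the rest of the front lie in nearly one direction, so a nontrivial
  rotation there makes any path through it turn straight. Hence a reduced product of rotations at the
  front moves points along a broken geodesic with long steps and small turns, which is a
  quasi-geodesic. It follows that the group generated by \<open>gen A\<close> and the rotations at the front is
  the free product of \<open>gen A\<close> with the rotation groups of a transversal of the front modulo \<open>gen A\<close>,
  that its new elements are rotations or have quasi-geodesic axes, and that the orbit of the enlarged
  set of apices is again a windmill. By Zorn's lemma the set of all apices is a windmill.
\<close>

section \<open>Gromov products and broken geodesics\<close>

lemma gromov_product_commute: "gromov_product x y w = gromov_product y x w"
  by (simp add: gromov_product_def dist_commute)

lemma gromov_product_self [simp]: "gromov_product x x w = dist w x"
  by (simp add: gromov_product_def)

lemma gromov_product_base [simp]: "gromov_product w x w = 0" "gromov_product x w w = 0"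
  by (simp_all add: gromov_product_def dist_commute)

lemma gromov_product_le_dist: "gromov_product x y w \<le> dist w x" "gromov_product x y w \<le> dist w y"
  using dist_triangle[of w y x] dist_triangle[of w x y]
  by (simp_all add: gromov_product_def dist_commute)

lemma gromov_product_nonneg: "gromov_product x y w \<ge> 0"
  using dist_triangle[of x y w] by (simp add: gromov_product_def dist_commute)

lemma gromov_product_swap: "gromov_product x y w = dist x w - gromov_product w y x"
  by (simp add: gromov_product_def dist_commute field_simps)

text \<open>If y lies almost on a geodesic from x to c, that is if (x|c)_y is small, then x can take
  the place of y in a product based at c at just that cost.\<close>

lemma gromov_product_move_left: "gromov_product x z c \<ge> gromov_product y z c - gromov_product x c y"
  using dist_triangle[of x z y] by (simp add: gromov_product_def dist_commute field_simps)

lemma gromov_product_move_right: "gromov_product x z c \<ge> gromov_product x y c - gromov_product c z y"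
  using dist_triangle[of x z y] by (simp add: gromov_product_def dist_commute field_simps)

lemma geodesic_between_point:
  assumes "geodesic_between x y S" and "0 \<le> t" "t \<le> dist x y"
  obtains p where "p \<in> S" "dist x p = t" "dist p y = dist x y - t"
proof -
  obtain \<gamma> where \<gamma>: "\<gamma> 0 = x" "\<gamma> (dist x y) = y" "S = \<gamma> ` {0..dist x y}"
    and iso: "\<forall>s\<in>{0..dist x y}. \<forall>t\<in>{0..dist x y}. dist (\<gamma> s) (\<gamma> t) = \<bar>s - t\<bar>"
    using assms(1) unfolding geodesic_between_def by blast
  show ?thesis
  proof (rule that[of "\<gamma> t"])
    show "\<gamma> t \<in> S" using \<gamma>(3) assms by auto
    show "dist x (\<gamma> t) = t" using iso[rule_format, of 0 t] \<gamma>(1) assms by auto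
    show "dist (\<gamma> t) y = dist x y - t"
      using iso[rule_format, of t "dist x y"] \<gamma>(2) assms by auto
  qed
qed

lemma geodesic_between_dist:
  assumes "geodesic_between x y S" and "p \<in> S"
  shows "dist x y = dist x p + dist p y"
proof -
  obtain \<gamma> where \<gamma>: "\<gamma> 0 = x" "\<gamma> (dist x y) = y" "S = \<gamma> ` {0..dist x y}"
    and iso: "\<forall>s\<in>{0..dist x y}. \<forall>t\<in>{0..dist x y}. dist (\<gamma> s) (\<gamma> t) = \<bar>s - t\<bar>"
    using assms(1) unfolding geodesic_between_def by blast
  obtain t where t: "p = \<gamma> t" "0 \<le> t" "t \<le> dist x y" using assms(2) \<gamma>(3) by auto
  show ?thesis
    using iso[rule_format, of 0 t] iso[rule_format, of t "dist x y"] \<gamma>(1,2) t by auto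
qed

lemma delta_hyperbolic_points:
  assumes "delta_hyperbolic \<delta> TYPE('x::metric_space)"
    and "geodesic_between (x::'x) y S" "geodesic_between x z S'" "p \<in> S" "q \<in> S'"
    and "dist x p = dist x q" "dist x q \<le> gromov_product y z x"
  shows "dist p q \<le> \<delta>"
proof -
  obtain S'' where "geodesic_between y z S''"
    using assms(1) unfolding delta_hyperbolic_def geodesic_space_def by blast
  then show ?thesis using assms unfolding delta_hyperbolic_def by blast
qed

text \<open>Take the points at distance t from w on geodesics to x, y and z, where t is the smaller
  of the two given products. Consecutive points are \<delta>-close, so d(x,z) <= d(w,x) + d(w,z) -
  2t + 2\<delta>, and halving leaves a loss of one \<delta>.\<close>

lemma delta_hyperbolic_four_point:
  assumes "delta_hyperbolic \<delta> TYPE('x::metric_space)"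
  shows "min (gromov_product x y w) (gromov_product y z w) - \<delta> \<le> gromov_product x z (w::'x)"
proof -
  define t where "t = min (gromov_product x y w) (gromov_product y z w)"
  have t: "0 \<le> t" "t \<le> gromov_product x y w" "t \<le> gromov_product y z w"
    using gromov_product_nonneg[of x y w] gromov_product_nonneg[of y z w] by (auto simp: t_def)
  have td: "t \<le> dist w x" "t \<le> dist w y" "t \<le> dist w z"
    using t gromov_product_le_dist[of x y w] gromov_product_le_dist[of y z w] by auto
  have geo: "\<exists>S. geodesic_between w v S" for v
    using assms unfolding delta_hyperbolic_def geodesic_space_def by blast
  obtain Sx Sy Sz where S: "geodesic_between w x Sx" "geodesic_between w y Sy" "geodesic_between w z Sz"
    using geo by blast
  obtain p where p: "p \<in> Sx" "dist w p = t" "dist p x = dist w x - t"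
    using geodesic_between_point[OF S(1) t(1) td(1)] .
  obtain q where q: "q \<in> Sy" "dist w q = t" "dist q y = dist w y - t"
    using geodesic_between_point[OF S(2) t(1) td(2)] .
  obtain r where r: "r \<in> Sz" "dist w r = t" "dist r z = dist w z - t"
    using geodesic_between_point[OF S(3) t(1) td(3)] .
  have "dist p q \<le> \<delta>" "dist q r \<le> \<delta>"
    using delta_hyperbolic_points[OF assms S(1,2) p(1) q(1)] p q t
      delta_hyperbolic_points[OF assms S(2,3) q(1) r(1)] r by auto
  then have "dist x z \<le> (dist w x - t) + 2 * \<delta> + (dist w z - t)"
    using dist_triangle[of x z p] dist_triangle[of p z r] dist_triangle[of p r q] p r
    by (simp add: dist_commute)
  then show ?thesis unfolding t_def[symmetric] by (simp add: gromov_product_def field_simps)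
qed

section \<open>Broken geodesics with long segments and small turns\<close>

text \<open>The turn at a vertex is measured by the Gromov product of its two neighbours, so the
  last vertex has none. The bound \<delta>/2 is the one that \<open>rotation_turn\<close>
  delivers.\<close>

fun taut :: "real \<Rightarrow> 'x::metric_space list \<Rightarrow> bool" where
  "taut \<delta> (x # y # zs) \<longleftrightarrow>
     20 * \<delta> \<le> dist x y \<and> (zs \<noteq> [] \<longrightarrow> gromov_product x (hd zs) y \<le> \<delta> / 2) \<and> taut \<delta> (y # zs)"
| "taut \<delta> _ \<longleftrightarrow> True"

locale four_point_space =
  fixes \<delta> :: real and space :: "'x::metric_space itself"
  assumes delta_pos: "\<delta> > 0"
    and four_point: "min (gromov_product x y w) (gromov_product y z w) - \<delta> \<le> gromov_product x z (w::'x)"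
begin

text \<open>Write e for the last vertex. By induction (y|e)_z is small, so (z|e)_y = d(y,z) -
  (y|e)_z is at least 18\<delta>: from y, the points z and e lie in the same direction. The
  four-point inequality then transfers the bound on (x|z)_y to (x|e)_y and adds one
  \<delta>.\<close>

lemma taut_first_turn:
  fixes x :: 'x
  assumes "taut \<delta> (x # y # zs)" "zs \<noteq> []"
  shows "gromov_product x (last zs) y \<le> 3/2 * \<delta>"
  using assms
proof (induction zs arbitrary: x y)
  case (Cons z zs)
  show ?case
  proof (cases zs)
    case Nil
    then show ?thesis using Cons.prems delta_pos by auto
  next
    case (Cons z' zs')
    have "gromov_product y (last zs) z \<le> 3/2 * \<delta>"
      using Cons.IH[of y z] Cons.prems Cons by simp
    moreover have "20 * \<delta> \<le> dist y z" "gromov_product x z y \<le> \<delta> / 2"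
      using Cons.prems by auto
    moreover have "last (z # zs) = last zs" using Cons by simp
    moreover have "gromov_product z (last zs) y = dist z y - gromov_product y (last zs) z"
      by (rule gromov_product_swap)
    ultimately show ?thesis
      using four_point[of x "last zs" y z] delta_pos
      by (auto simp: dist_commute gromov_product_commute min_def split: if_splits)
  qed
qed simp

text \<open>Same argument as for \<open>taut_first_turn\<close>, starting from a turn of 3/2 *
  \<delta> instead of \<delta>/2.\<close>

lemma taut_turn:
  fixes x :: 'x
  assumes "gromov_product x (hd zs) y \<le> 3/2 * \<delta>" "taut \<delta> (y # zs)" "zs \<noteq> []"
  shows "gromov_product x (last zs) y \<le> 5/2 * \<delta>"
proof (cases "tl zs = []")
  case True
  then show ?thesis using assms delta_pos by (cases zs) auto
next
  case False
  then obtain z zs' where zs: "zs = z # zs'" "zs' \<noteq> []" using assms by (cases zs) auto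
  have "gromov_product y (last zs) z \<le> 3/2 * \<delta>" "20 * \<delta> \<le> dist y z"
    using taut_first_turn[of y z zs'] assms zs by auto
  moreover have "gromov_product z (last zs) y = dist z y - gromov_product y (last zs) z"
    by (rule gromov_product_swap)
  ultimately show ?thesis
    using four_point[of x "last zs" y z] delta_pos assms(1) zs
    by (auto simp: dist_commute gromov_product_commute min_def split: if_splits)
qed

text \<open>Skipping the vertex \<open>y\<close> leaves a broken geodesic whose first turn is at most \<open>3/2 * \<delta>\<close>,
  so the estimate at the second vertex does not deteriorate along the path.\<close>

lemma taut_all_turns_aux:
  fixes x :: 'x
  assumes "gromov_product x (hd zs) y \<le> 3/2 * \<delta>" "taut \<delta> (y # zs)" "zs \<noteq> []" "w \<in> set (butlast (y # zs))"
  shows "gromov_product x (last zs) w \<le> 5/2 * \<delta>"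
  using assms
proof (induction zs arbitrary: y)
  case (Cons z zs)
  show ?case
  proof (cases "w = y")
    case True
    then show ?thesis using taut_turn[of x "z # zs" y] Cons.prems by simp
  next
    case False
    then have w: "w \<in> set (butlast (z # zs))" "zs \<noteq> []" using Cons.prems by (auto split: if_splits)
    have "gromov_product y (hd zs) z \<le> \<delta> / 2" "20 * \<delta> \<le> dist y z" "gromov_product x z y \<le> 3/2 * \<delta>"
      using Cons.prems w by auto
    moreover have "gromov_product y x z = dist y z - gromov_product z x y"
      by (rule gromov_product_swap)
    ultimately have "gromov_product x (hd zs) z \<le> 3/2 * \<delta>"
      using four_point[of y x z "hd zs"] delta_pos
      by (auto simp: dist_commute gromov_product_commute min_def split: if_splits)
    then show ?thesis using Cons.IH[of z] Cons.prems w by auto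
  qed
qed simp

lemma taut_all_turns:
  fixes x :: 'x
  assumes "taut \<delta> (x # zs)" "w \<in> set (butlast zs)"
  shows "gromov_product x (last zs) w \<le> 5/2 * \<delta>"
proof (cases zs)
  case (Cons y zs')
  then show ?thesis using taut_all_turns_aux[of x zs' y w] assms delta_pos
    by (cases "zs' = []") auto
qed (use assms in auto)

text \<open>Since d(x,e) = d(x,y) + d(y,e) - 2 (x|e)_y, every segment of length at least 20\<delta>
  loses at most twice 3/2 * \<delta>.\<close>

lemma taut_length:
  fixes x :: 'x
  assumes "taut \<delta> (x # zs)"
  shows "17 * \<delta> * length zs \<le> dist x (last (x # zs))"
  using assms
proof (induction zs arbitrary: x)
  case (Cons y zs)
  show ?case
  proof (cases "zs = []")
    case True
    then show ?thesis using Cons.prems delta_pos by simp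
  next
    case False
    have "17 * \<delta> * length zs \<le> dist y (last zs)" using Cons.IH[of y] Cons.prems False by simp
    moreover have "gromov_product x (last zs) y \<le> 3/2 * \<delta>"
      using taut_first_turn Cons.prems False by blast
    moreover have "20 * \<delta> \<le> dist x y" using Cons.prems by simp
    ultimately show ?thesis using False
      by (simp add: gromov_product_def field_simps dist_commute)
  qed
qed simp

text \<open>The invariant (x|c)_y <= 7/2 * \<delta> says that y lies almost on a geodesic from x to
  c. At the next vertex z the four-point inequality leaves two cases. Either z inherits the
  invariant, or z lies almost on a geodesic from c to e; then c is seen from the segment between y
  and z, and replacing y by x and z by e costs 7/2 * \<delta> each.\<close>

lemma gromov_product_along_path_aux:
  fixes x :: 'x
  assumes "\<And>w. w \<in> set ps \<Longrightarrow> gromov_product x e w \<le> 5/2 * \<delta>"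
    and "successively (\<lambda>u v. M \<le> gromov_product u v c) (y # ps @ [e])"
    and "gromov_product x c y \<le> 7/2 * \<delta>"
  shows "M - 7 * \<delta> \<le> gromov_product x e c"
  using assms
proof (induction ps arbitrary: y)
  case Nil
  then show ?case using gromov_product_move_left[of y e c x] delta_pos by simp
next
  case (Cons z ps)
  have M: "M \<le> gromov_product y z c" using Cons.prems by simp
  have "min (gromov_product x c z) (gromov_product c e z) - \<delta> \<le> 5/2 * \<delta>"
    using four_point[of x c z e] Cons.prems(1)[of z] by simp
  then consider "gromov_product x c z \<le> 7/2 * \<delta>" | "gromov_product c e z \<le> 7/2 * \<delta>"
    by (auto simp: min_def split: if_splits)
  then show ?case
  proof cases
    case 1
    then show ?thesis by (intro Cons.IH[of z]) (use Cons.prems in auto)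
  next
    case 2
    then show ?thesis
      using M gromov_product_move_left[of y z c x] gromov_product_move_right[of x z c e] Cons.prems(3) by linarith
  qed
qed

text \<open>The loss does not depend on the number of segments: the path follows a geodesic, so \<open>c\<close> is
  seen from one particular segment.\<close>

lemma gromov_product_along_path:
  fixes x :: 'x
  assumes "\<And>w. w \<in> set ps \<Longrightarrow> gromov_product x e w \<le> 5/2 * \<delta>"
    and "successively (\<lambda>u v. M \<le> gromov_product u v c) (x # ps @ [e])"
  shows "M - 7 * \<delta> \<le> gromov_product x e c"
  using gromov_product_along_path_aux[OF assms] delta_pos by simp

end

section \<open>Words and free products\<close>

context group
begin

lemma inv_mult_cancel [simp]:
  assumes "g \<in> carrier G" "h \<in> carrier G"
  shows "inv g \<otimes> (g \<otimes> h) = h" "g \<otimes> (inv g \<otimes> h) = h"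
  using assms by (simp_all flip: m_assoc)

text \<open>Trivial letters and neighbours with equal index are allowed, so that words can be
  concatenated and inverted before they are reduced.\<close>

definition words :: "'i set \<Rightarrow> ('i \<Rightarrow> 'a set) \<Rightarrow> ('i \<times> 'a) list set" where
  "words I K = {w. \<forall>(i, x)\<in>set w. i \<in> I \<and> x \<in> K i}"

lemma words_Nil [simp]: "[] \<in> words I K"
  and words_Cons [simp]: "(i, x) # w \<in> words I K \<longleftrightarrow> i \<in> I \<and> x \<in> K i \<and> w \<in> words I K"
  and words_append [simp]: "v @ w \<in> words I K \<longleftrightarrow> v \<in> words I K \<and> w \<in> words I K"
  by (auto simp: words_def)

lemma reduced_words_Nil [simp]: "[] \<in> reduced_words G I K"
  by (simp add: reduced_words_def)

lemma reduced_words_Cons: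
  "(i, x) # w \<in> reduced_words G I K \<longleftrightarrow>
     i \<in> I \<and> x \<in> K i \<and> x \<noteq> \<one> \<and> w \<in> reduced_words G I K \<and> (w \<noteq> [] \<longrightarrow> fst (hd w) \<noteq> i)"
  by (cases w) (auto simp: reduced_words_def)

lemma reduced_words_append:
  "v @ w \<in> reduced_words G I K \<longleftrightarrow>
     v \<in> reduced_words G I K \<and> w \<in> reduced_words G I K \<and>
     (v \<noteq> [] \<and> w \<noteq> [] \<longrightarrow> fst (last v) \<noteq> fst (hd w))"
  by (auto simp: reduced_words_def distinct_adj_append_iff last_map hd_map)

lemma reduced_words_subset: "reduced_words G I K \<subseteq> words I K"
  by (auto simp: reduced_words_def words_def)

lemma word_value_Nil [simp]: "word_value G [] = \<one>"
  and word_value_Cons [simp]: "word_value G ((i, x) # w) = x \<otimes> word_value G w"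
  by (simp_all add: word_value_def)

lemma word_value_closed [simp]:
  assumes "\<And>i. i \<in> I \<Longrightarrow> K i \<subseteq> carrier G" "w \<in> words I K"
  shows "word_value G w \<in> carrier G"
  using assms(2)
proof (induction w)
  case (Cons a w)
  then show ?case using assms(1)[of "fst a"] by (cases a) auto
qed simp

lemma reduced_word_value_closed:
  assumes "\<And>i. i \<in> I \<Longrightarrow> K i \<subseteq> carrier G" "w \<in> reduced_words G I K"
  shows "word_value G w \<in> carrier G"
  using word_value_closed[of I K, OF assms(1)] assms(2) subsetD[OF reduced_words_subset[of I K]] by metis

lemma word_value_append:
  assumes "\<And>i. i \<in> I \<Longrightarrow> K i \<subseteq> carrier G" "v \<in> words I K" "w \<in> words I K"
  shows "word_value G (v @ w) = word_value G v \<otimes> word_value G w"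
  using assms(2)
proof (induction v)
  case Nil
  then show ?case using word_value_closed[of I K w] assms by simp
next
  case (Cons a v)
  obtain i x where a: "a = (i, x)" by force
  have "x \<in> carrier G" using assms(1) Cons.prems a by auto
  then show ?case
    using Cons a word_value_closed[of I K v] word_value_closed[of I K w] assms by (simp add: m_assoc)
qed

text \<open>Letters are prepended one at a time; a letter that meets its own factor is merged with
  the head, and trivial letters are dropped. The length bound drives the induction in
  \<open>hub_dichotomy_word\<close>.\<close>

lemma exists_reduced_word:
  assumes K: "\<And>i. i \<in> I \<Longrightarrow> subgroup (K i) G" and "w \<in> words I K"
  shows "\<exists>w'\<in>reduced_words G I K. word_value G w' = word_value G w \<and> length w' \<le> length w"
  using assms(2)
proof (induction w)
  case Nil
  show ?case by (rule bexI[of _ "[]"]) auto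
next
  case (Cons a w)
  obtain i x where a: "a = (i, x)" by force
  have i: "i \<in> I" "x \<in> K i" using Cons.prems a by auto
  have car: "\<And>i. i \<in> I \<Longrightarrow> K i \<subseteq> carrier G" using K subgroup.subset by blast
  have xc: "x \<in> carrier G" using car i by auto
  obtain w' where w': "w' \<in> reduced_words G I K" "word_value G w' = word_value G w" "length w' \<le> length w"
    using Cons a by auto
  have wc: "word_value G w' \<in> carrier G"
    using w' reduced_words_subset word_value_closed[of I K] car by blast
  show ?case
  proof (cases "x = \<one>")
    case True
    then show ?thesis using w' a wc by (intro bexI[of _ w']) auto
  next
    case x1: False
    show ?thesis
    proof (cases "w' \<noteq> [] \<and> fst (hd w') = i")
      case False
      then show ?thesis using w' a i x1 by (intro bexI[of _ "(i, x) # w'"]) (auto simp: reduced_words_Cons)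
    next
      case True
      then obtain y w2 where w2: "w' = (i, y) # w2" by (cases w') auto
      have y: "y \<in> K i" "w2 \<in> reduced_words G I K" "w2 \<noteq> [] \<longrightarrow> fst (hd w2) \<noteq> i"
        using w' w2 by (auto simp: reduced_words_Cons)
      have xy: "x \<otimes> y \<in> K i" using K i y subgroup.m_closed by metis
      have yc: "y \<in> carrier G" using car y i by auto
      have w2c: "word_value G w2 \<in> carrier G"
        using y reduced_words_subset word_value_closed[of I K] car by blast
      have v: "word_value G (a # w) = (x \<otimes> y) \<otimes> word_value G w2"
        using a w2 w'(2) xc yc w2c by (simp add: m_assoc flip: w'(2))
      show ?thesis
      proof (cases "x \<otimes> y = \<one>")
        case True
        then show ?thesis using v y w2c w' w2 by (intro bexI[of _ w2]) auto
      next
        case False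
        then show ?thesis using v y w2c w' w2 xy i
          by (intro bexI[of _ "(i, x \<otimes> y) # w2"]) (auto simp: reduced_words_Cons)
      qed
    qed
  qed
qed

lemma word_value_in_generate:
  assumes "w \<in> words I K"
  shows "word_value G w \<in> generate G (\<Union>i\<in>I. K i)"
  using assms
proof (induction w)
  case Nil
  show ?case by (simp add: generate.one)
next
  case (Cons a w)
  then show ?case by (cases a) (auto intro: generate.eng[OF generate.incl])
qed

lemma inverse_word:
  assumes K: "\<And>i. i \<in> I \<Longrightarrow> subgroup (K i) G" and w: "w \<in> words I K"
  defines "w' \<equiv> rev (map (\<lambda>(i, x). (i, inv x)) w)"
  shows "w' \<in> words I K" "word_value G w' = inv (word_value G w)"
proof -
  have car: "\<And>i. i \<in> I \<Longrightarrow> K i \<subseteq> carrier G" using K subgroup.subset by blast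
  show W: "w' \<in> words I K"
    unfolding w'_def using w K by (auto simp: words_def subgroup.m_inv_closed split: prod.splits)
  show "word_value G w' = inv (word_value G w)"
    unfolding w'_def using w
  proof (induction w)
    case (Cons a w)
    obtain i x where a: "a = (i, x)" by force
    have i: "i \<in> I" "x \<in> K i" "w \<in> words I K" using Cons.prems a by auto
    have "rev (map (\<lambda>(i, x). (i, inv x)) w) \<in> words I K"
      using i K by (auto simp: words_def subgroup.m_inv_closed split: prod.splits)
    moreover have "[(i, inv x)] \<in> words I K" using i K subgroup.m_inv_closed by fastforce
    moreover have "x \<in> carrier G" using i car by auto
    ultimately show ?case
      using Cons.IH a word_value_append[of I K "rev (map (\<lambda>(i, x). (i, inv x)) w)" "[(i, inv x)]"]
        car i word_value_closed[of I K w] by (simp add: inv_mult_group)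
  qed simp
qed

lemma word_value_inverse_append:
  assumes K: "\<And>i. i \<in> I \<Longrightarrow> subgroup (K i) G" and "v \<in> words I K" "w \<in> words I K"
  shows "word_value G (rev (map (\<lambda>(i, x). (i, inv x)) v) @ w) = inv (word_value G v) \<otimes> word_value G w"
  using word_value_append[of I K "rev (map (\<lambda>(i, x). (i, inv x)) v)" w]
    inverse_word[of I K v, OF K] assms subgroup.subset by metis

lemma inverse_reduced_word:
  assumes K: "\<And>i. i \<in> I \<Longrightarrow> subgroup (K i) G" and w: "w \<in> reduced_words G I K"
  shows "rev (map (\<lambda>(i, x). (i, inv x)) w) \<in> reduced_words G I K"
proof -
  have "inv x \<in> K i - {\<one>}" if "i \<in> I" "x \<in> K i - {\<one>}" for i x
    using K[OF that(1)] that subgroup.m_inv_closed subgroup.mem_carrier[of "K i"] by fastforce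
  moreover have "map fst (rev (map (\<lambda>(i, x). (i, inv x)) w)) = rev (map fst w)"
    by (simp add: rev_map comp_def case_prod_unfold)
  ultimately show ?thesis using w unfolding reduced_words_def by fastforce
qed

lemma word_value_image_words:
  assumes K: "\<And>i. i \<in> I \<Longrightarrow> subgroup (K i) G"
  shows "word_value G ` reduced_words G I K = generate G (\<Union>i\<in>I. K i)"
proof
  show "word_value G ` reduced_words G I K \<subseteq> generate G (\<Union>i\<in>I. K i)"
    using word_value_in_generate reduced_words_subset by blast
  have car: "\<And>i. i \<in> I \<Longrightarrow> K i \<subseteq> carrier G" using K subgroup.subset by blast
  have ex: "\<exists>w\<in>words I K. word_value G w = g" if "g \<in> generate G (\<Union>i\<in>I. K i)" for g
    using that
  proof induction
    case one
    show ?case by (rule bexI[of _ "[]"]) auto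
  next
    case (incl h)
    then obtain i where "i \<in> I" "h \<in> K i" by auto
    then show ?case using car[of i] by (intro bexI[of _ "[(i, h)]"]) auto
  next
    case (inv h)
    then obtain i where i: "i \<in> I" "h \<in> K i" by auto
    then have "inv h \<in> K i" using subgroup.m_inv_closed[OF K] by simp
    with i show ?case using car[of i] by (intro bexI[of _ "[(i, inv h)]"]) auto
  next
    case (eng h1 h2)
    then obtain w1 w2 where "w1 \<in> words I K" "w2 \<in> words I K" "word_value G w1 = h1" "word_value G w2 = h2"
      by blast
    then show ?case using word_value_append[of I K w1 w2, OF car] by (intro bexI[of _ "w1 @ w2"]) simp_all
  qed
  show "generate G (\<Union>i\<in>I. K i) \<subseteq> word_value G ` reduced_words G I K"
  proof (intro subsetI)
    fix g assume "g \<in> generate G (\<Union>i\<in>I. K i)"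
    from ex[OF this] obtain w where "w \<in> words I K" "word_value G w = g" by blast
    moreover from this have "\<exists>w'\<in>reduced_words G I K. word_value G w' = word_value G w \<and> length w' \<le> length w"
      by (intro exists_reduced_word K)
    ultimately show "g \<in> word_value G ` reduced_words G I K" by (metis imageI)
  qed
qed

text \<open>Two different words with the same value would yield, after cancelling their common
  beginning, a nonempty reduced word with value one: the inverse of the first followed by the
  second.\<close>

lemma inj_on_word_value:
  assumes K: "\<And>i. i \<in> I \<Longrightarrow> subgroup (K i) G"
    and triv: "\<And>w. w \<in> reduced_words G I K \<Longrightarrow> word_value G w = \<one> \<Longrightarrow> w = []"
  shows "inj_on (word_value G) (reduced_words G I K)"
proof -
  have car: "\<And>i. i \<in> I \<Longrightarrow> K i \<subseteq> carrier G" using K subgroup.subset by blast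
  have "w1 = w2" if "w1 \<in> reduced_words G I K" "w2 \<in> reduced_words G I K"
    "word_value G w1 = word_value G w2" for w1 w2
    using that
  proof (induction w1 arbitrary: w2)
    case Nil
    then show ?case using triv[of w2] by simp
  next
    case (Cons a w)
    obtain i x where a: "a = (i, x)" by force
    note red = Cons.prems(1)[unfolded a reduced_words_Cons]
    show ?case
    proof (cases w2)
      case Nil
      then show ?thesis using triv[of "a # w"] Cons.prems by simp
    next
      case (Cons b v)
      obtain j y where b: "b = (j, y)" by force
      note red2 = Cons.prems(2)[unfolded Cons b reduced_words_Cons]
      let ?iw = "\<lambda>w. rev (map (\<lambda>(i, x). (i, inv x)) w)"
      have c: "x \<in> carrier G" "y \<in> carrier G" "word_value G w \<in> carrier G" "word_value G v \<in> carrier G"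
        using car[of i] car[of j] red red2 reduced_word_value_closed[of I K w, OF car]
          reduced_word_value_closed[of I K v, OF car] by auto
      have eq: "x \<otimes> word_value G w = y \<otimes> word_value G v"
        using Cons.prems(3) a b Cons by simp
      show ?thesis
      proof (cases "i = j")
        case False
        \<comment> \<open>The first indices differ, so nothing cancels at the junction and the word
          is reduced as it stands.\<close>
        let ?u = "?iw (a # w) @ w2"
        have "last (?iw (a # w)) = (i, inv x)" using a by simp
        then have "?u \<in> reduced_words G I K"
          using inverse_reduced_word[OF K Cons.prems(1)] Cons.prems(2) False Cons b
          unfolding reduced_words_append by simp
        moreover have "word_value G ?u = inv (word_value G (a # w)) \<otimes> word_value G w2"
          using word_value_inverse_append[of I K "a # w" w2, OF K] Cons.prems reduced_words_subset[of I K]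
          by (simp add: subset_iff)
        then have "word_value G ?u = \<one>"
          using c a by (simp flip: Cons.prems(3))
        ultimately have "?u = []" using triv by blast
        then show ?thesis using Cons by simp
      next
        case ij: True
        show ?thesis
        proof (cases "x = y")
          case True
          then have "word_value G w = word_value G v" using eq c by simp
          then show ?thesis using Cons.IH[of v] red red2 ij True a b Cons by simp
        next
          case False
          \<comment> \<open>The two first letters lie in one factor but differ, so at the junction
            they merge into one nontrivial letter.\<close>
          let ?z = "inv x \<otimes> y"
          let ?u = "?iw w @ (i, ?z) # v"
          have z: "?z \<in> K i" using K red red2 ij by (simp add: subgroup.m_closed subgroup.m_inv_closed)
          have z1: "?z \<noteq> \<one>" using False c by (metis inv_equality inv_inv inv_closed)
          have zv: "(i, ?z) # v \<in> reduced_words G I K" using red2 z z1 ij by (simp add: reduced_words_Cons)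
          have "fst (last (?iw w)) \<noteq> i" if "w \<noteq> []" using red that by (cases w) auto
          then have "?u \<in> reduced_words G I K"
            using inverse_reduced_word[of I K w, OF K] red zv unfolding reduced_words_append by auto
          moreover have "word_value G ?u = inv (word_value G w) \<otimes> word_value G ((i, ?z) # v)"
              using red zv reduced_words_subset[of I K] by (intro word_value_inverse_append[of I K] K) (simp_all add: subset_iff del: words_Cons)
          then have "word_value G ?u = inv (word_value G w) \<otimes> (inv x \<otimes> (y \<otimes> word_value G v))"
            using c by (simp add: m_assoc)
          then have "word_value G ?u = \<one>" using c by (simp flip: eq add: m_assoc[symmetric])
          ultimately have "?u = []" using triv by blast
          then show ?thesis by simp
        qed
      qed
    qed
  qed
  then show ?thesis by (intro inj_onI)
qed

text \<open>Restricting the carrier changes neither the unit nor the multiplication, so words and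
  values may be computed in \<open>G\<close>; existence of a reduced word is generation, uniqueness
  is \<open>triv\<close>.\<close>

lemma is_free_productI:
  fixes K :: "'i \<Rightarrow> 'a set"
  assumes K: "\<And>i. i \<in> I \<Longrightarrow> subgroup (K i) G"
    and triv: "\<And>w. w \<in> reduced_words G I K \<Longrightarrow> word_value G w = \<one> \<Longrightarrow> w = []"
    and N: "N = generate G (\<Union>i\<in>I. K i)"
  shows "is_free_product (G\<lparr>carrier := N\<rparr>) I K"
proof -
  have KG: "(\<Union>i\<in>I. K i) \<subseteq> carrier G" using K subgroup.subset by blast
  then have sub: "subgroup N G" using N generate_is_subgroup by simp
  have KN: "K i \<subseteq> N" if "i \<in> I" for i using that N by (auto intro: generate.incl)
  have "reduced_words (G\<lparr>carrier := N\<rparr>) I K = reduced_words G I K"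
    by (simp add: reduced_words_def)
  moreover have "word_value (G\<lparr>carrier := N\<rparr>) = (word_value G :: ('i \<times> 'a) list \<Rightarrow> 'a)"
    by (simp add: word_value_def fun_eq_iff)
  moreover have "inj_on (word_value G) (reduced_words G I K)"
    by (rule inj_on_word_value[OF K triv])
  moreover have "word_value G ` reduced_words G I K = N"
    using word_value_image_words[OF K] N by simp
  ultimately show ?thesis
    unfolding is_free_product_def bij_betw_def
    using subgroup_imp_group[OF sub] subgroup_incl[OF K sub KN] by simp
qed

end

section \<open>Rotating families\<close>

lemma conj_set_eq: "conj_set G g H = (\<lambda>h. g \<otimes>\<^bsub>G\<^esub> h \<otimes>\<^bsub>G\<^esub> inv\<^bsub>G\<^esub> g) ` H"
  by (auto simp: conj_set_def l_coset_def r_coset_def)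

text \<open>For a word (c1,r1) (c2,r2) ... the path visits c1, r1 c2, r1 r2 c3 and so on, and ends
  at the image of \<open>v\<close> under the value of the word. When each letter fixes its own apex,
  the vertices are exactly the points about which the successive translates are rotated.\<close>

fun path_points :: "('g \<Rightarrow> 'x \<Rightarrow> 'x) \<Rightarrow> ('x \<times> 'g) list \<Rightarrow> 'x \<Rightarrow> 'x list" where
  "path_points \<phi> [] v = [v]"
| "path_points \<phi> ((c, r) # w) v = c # map (\<phi> r) (path_points \<phi> w v)"

lemma length_path_points [simp]: "length (path_points \<phi> w v) = Suc (length w)"
  by (induction w) auto

lemma path_points_not_Nil [simp]: "path_points \<phi> w v \<noteq> []"
  by (cases w) auto

lemma hd_in_butlast_path_points: "w \<noteq> [] \<Longrightarrow> fst (hd w) \<in> set (butlast (path_points \<phi> w v))"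
  by (cases w) auto

locale rotating_group = isometric_action G \<phi>
  for G :: "('g, 'b) monoid_scheme" (structure)
    and \<phi> :: "'g \<Rightarrow> 'x::metric_space \<Rightarrow> 'x" +
  fixes \<delta> :: real and C :: "'x set" and R :: "'x \<Rightarrow> 'g set"
  assumes pos: "\<delta> > 0"
    and hyp: "delta_hyperbolic \<delta> TYPE('x)"
    and rot: "rotating_family G \<phi> C R"
    and sep: "separated (200 * \<delta>) C"
    and very: "very_rotating G \<phi> \<delta> C R"

sublocale rotating_group \<subseteq> four_point_space \<delta> "TYPE('x)"
  by unfold_locales (use pos delta_hyperbolic_four_point[OF hyp] in auto)

sublocale rotating_group \<subseteq> group G
  using group_hom group_hom.axioms(1) by blast

section \<open>The action on apices and the turn made by a rotation\<close>

context rotating_group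
begin

lemma act_mult: "g \<in> carrier G \<Longrightarrow> h \<in> carrier G \<Longrightarrow> \<phi> (g \<otimes> h) x = \<phi> g (\<phi> h x)"
  using composition_rule by simp

lemma act_one [simp]: "\<phi> \<one> x = x"
  using id_eq_one by (metis UNIV_I restrict_apply')

lemma act_inv [simp]:
  "g \<in> carrier G \<Longrightarrow> \<phi> (inv g) (\<phi> g x) = x" "g \<in> carrier G \<Longrightarrow> \<phi> g (\<phi> (inv g) x) = x"
  using act_mult[of "inv g" g x] act_mult[of g "inv g" x] by simp_all

lemma act_eq_iff: "g \<in> carrier G \<Longrightarrow> \<phi> g x = \<phi> g y \<longleftrightarrow> x = y"
  using act_inv(1) by metis

lemma gromov_product_act:
  "g \<in> carrier G \<Longrightarrow> gromov_product (\<phi> g x) (\<phi> g y) (\<phi> g w) = gromov_product x y w"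
  by (simp add: gromov_product_def isometric)

lemma gromov_product_act_inv:
  "g \<in> carrier G \<Longrightarrow> gromov_product (\<phi> g x) (\<phi> g y) w = gromov_product x y (\<phi> (inv g) w)"
  using gromov_product_act[of g x y "\<phi> (inv g) w"] by simp

lemma taut_map_act:
  "g \<in> carrier G \<Longrightarrow> taut d (map (\<phi> g) xs) = taut d xs"
  by (induction d xs rule: taut.induct) (auto simp: gromov_product_act isometric hd_map)

lemma apex_act: "g \<in> carrier G \<Longrightarrow> c \<in> C \<Longrightarrow> \<phi> g c \<in> C"
  using rot unfolding rotating_family_def by blast

lemma R_subgroup: "c \<in> C \<Longrightarrow> subgroup (R c) G"
  using rot unfolding rotating_family_def by blast

lemma R_carrier: "c \<in> C \<Longrightarrow> R c \<subseteq> carrier G"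
  using R_subgroup subgroup.subset by blast

lemma R_fix: "c \<in> C \<Longrightarrow> r \<in> R c \<Longrightarrow> \<phi> r c = c"
  using rot unfolding rotating_family_def by blast

lemma R_act:
  assumes "g \<in> carrier G" "c \<in> C"
  shows "R (\<phi> g c) = (\<lambda>r. g \<otimes> r \<otimes> inv g) ` R c"
  using rot assms unfolding rotating_family_def conj_set_eq by blast

lemma apex_dist: "c \<in> C \<Longrightarrow> c' \<in> C \<Longrightarrow> c \<noteq> c' \<Longrightarrow> 200 * \<delta> \<le> dist c c'"
  using sep unfolding separated_def by blast

text \<open>Near \<open>c\<close> the geodesics from \<open>c\<close> to \<open>u\<close> and to \<open>v\<close> run together, so the very rotating
  condition forces every geodesic joining points near them to pass through \<open>c\<close> once \<open>v\<close> is rotated.\<close>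

lemma rotation_turn:
  assumes c: "c \<in> C" and r: "r \<in> R c" "r \<noteq> \<one>" and uv: "20 * \<delta> \<le> gromov_product u v c"
  shows "gromov_product u (\<phi> r v) c \<le> \<delta> / 2"
proof (rule ccontr)
  assume neg: "\<not> gromov_product u (\<phi> r v) c \<le> \<delta> / 2"
  have rc: "r \<in> carrier G" using R_carrier c r by blast
  have fx: "\<phi> r c = c" using R_fix c r by blast
  have geo: "\<exists>S. geodesic_between a b S" for a b :: 'x
    using hyp unfolding delta_hyperbolic_def geodesic_space_def by blast
  have du: "20 * \<delta> \<le> dist c u" "20 * \<delta> \<le> dist c v"
    using gromov_product_le_dist[of u v c] uv by auto
  have dv: "dist c (\<phi> r v) = dist c v" using isometric[OF rc, of c v] fx by simp
  obtain \<gamma> where \<gamma>: "\<gamma> 0 = c" "\<gamma> (dist c u) = u"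
    and \<gamma>_iso: "\<And>s t. s \<in> {0..dist c u} \<Longrightarrow> t \<in> {0..dist c u} \<Longrightarrow> dist (\<gamma> s) (\<gamma> t) = \<bar>s - t\<bar>"
    using geo[of c u] unfolding geodesic_between_def by blast
  obtain \<beta> where \<beta>: "\<beta> 0 = c" "\<beta> (dist c v) = v"
    and \<beta>_iso: "\<And>s t. s \<in> {0..dist c v} \<Longrightarrow> t \<in> {0..dist c v} \<Longrightarrow> dist (\<beta> s) (\<beta> t) = \<bar>s - t\<bar>"
    using geo[of c v] unfolding geodesic_between_def by blast
  have gu: "geodesic_between c u (\<gamma> ` {0..dist c u})"
    unfolding geodesic_between_def using \<gamma> \<gamma>_iso by blast
  have gv: "geodesic_between c v (\<beta> ` {0..dist c v})"
    unfolding geodesic_between_def using \<beta> \<beta>_iso by blast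
  have grv: "geodesic_between c (\<phi> r v) ((\<lambda>t. \<phi> r (\<beta> t)) ` {0..dist c v})"
    unfolding geodesic_between_def
    by (rule exI[of _ "\<lambda>t. \<phi> r (\<beta> t)"]) (use \<beta> \<beta>_iso fx dv isometric[OF rc] in auto)
  have \<gamma>_c: "dist c (\<gamma> t) = t" if "0 \<le> t" "t \<le> 20 * \<delta>" for t
    using \<gamma>_iso[of 0 t] \<gamma> du that by auto
  have \<beta>_c: "dist c (\<beta> t) = t" if "0 \<le> t" "t \<le> 20 * \<delta>" for t
    using \<beta>_iso[of 0 t] \<beta> du that by auto
  have r\<beta>_c: "dist c (\<phi> r (\<beta> t)) = t" if "0 \<le> t" "t \<le> 20 * \<delta>" for t
    using \<beta>_c[OF that] isometric[OF rc, of c "\<beta> t"] fx by simp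
  \<comment> \<open>The points are taken at distance 20\<delta> from \<open>c\<close>, the near end
    of the range in the very rotating condition.\<close>
  define x where "x = \<gamma> (20 * \<delta>)"
  define y where "y = \<phi> r (\<beta> (20 * \<delta>))"
  have dxy: "dist c x = 20 * \<delta>" "dist c y = 20 * \<delta>"
    unfolding x_def y_def using \<gamma>_c r\<beta>_c pos by auto
  have "dist x (\<beta> (20 * \<delta>)) \<le> \<delta>"
    unfolding x_def
    by (rule delta_hyperbolic_points[OF hyp gu gv]) (use \<gamma>_c \<beta>_c du pos uv in auto)
  then have close: "dist (\<phi> r x) y \<le> 15 * \<delta>"
    unfolding y_def isometric[OF rc] using pos by simp
  obtain S where S: "geodesic_between x y S" using geo by blast
  have "dist x c \<in> {20 * \<delta>..40 * \<delta>}" "dist y c \<in> {20 * \<delta>..40 * \<delta>}"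
    using dxy pos by (auto simp: dist_commute)
  then have "c \<in> S"
    using very c r S close unfolding very_rotating_def by blast
  then have xy: "dist x y = 40 * \<delta>" using geodesic_between_dist[OF S] dxy by (simp add: dist_commute)
  \<comment> \<open>A shortcut at distance t from \<open>c\<close> gives d(x,y) <= 2 (20\<delta> -
    t) + \<delta>, which is below 40\<delta> because t > \<delta>/2.\<close>
  define t where "t = min (gromov_product u (\<phi> r v) c) (20 * \<delta>)"
  have t: "\<delta> / 2 < t" "t \<le> 20 * \<delta>" "t \<le> gromov_product u (\<phi> r v) c"
    using neg pos by (auto simp: t_def)
  have "dist (\<gamma> t) (\<phi> r (\<beta> t)) \<le> \<delta>"
    by (rule delta_hyperbolic_points[OF hyp gu grv]) (use \<gamma>_c r\<beta>_c t pos du in auto)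
  moreover have "dist x (\<gamma> t) = 20 * \<delta> - t"
    unfolding x_def using \<gamma>_iso[of "20 * \<delta>" t] t du pos by auto
  moreover have "dist (\<phi> r (\<beta> t)) y = 20 * \<delta> - t"
    unfolding y_def isometric[OF rc] using \<beta>_iso[of t "20 * \<delta>"] t du pos by auto
  ultimately show False
    using dist_triangle[of x y "\<gamma> t"] dist_triangle[of "\<gamma> t" y "\<phi> r (\<beta> t)"] xy t by linarith
qed

text \<open>With u = v = c', the turn at c would be (c'|c')_c = d(c,c'), which separation makes far
  larger than \<delta>/2.\<close>

lemma rotation_fixes_one_apex:
  assumes "c \<in> C" "c' \<in> C" "r \<in> R c" "r \<noteq> \<one>" "\<phi> r c' = c'"
  shows "c' = c"
proof (rule ccontr)
  assume "c' \<noteq> c"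
  then have "200 * \<delta> \<le> dist c c'" using apex_dist assms by auto
  then show False using rotation_turn[of c r c' c'] assms pos by simp
qed

section \<open>Elements of linear growth\<close>

text \<open>The substantial half of being loxodromic, restricted to natural powers and one base
  point; for an isometry the rest is automatic.\<close>

definition linear_growth :: "'g \<Rightarrow> bool" where
  "linear_growth g \<longleftrightarrow> (\<exists>s. \<exists>\<epsilon>>0. \<forall>n::nat. \<epsilon> * real n \<le> dist s (\<phi> (g [^] n) s))"

lemma linear_growth_conj:
  assumes "linear_growth g" "g \<in> carrier G" "h \<in> carrier G"
  shows "linear_growth (h \<otimes> g \<otimes> inv h)"
proof -
  obtain s \<epsilon> where s: "\<epsilon> > 0" "\<And>n::nat. \<epsilon> * real n \<le> dist s (\<phi> (g [^] n) s)"
    using assms(1) unfolding linear_growth_def by blast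
  have pow: "(h \<otimes> g \<otimes> inv h) [^] n = h \<otimes> g [^] n \<otimes> inv h" for n :: nat
  proof (induction n)
    case (Suc n)
    then show ?case using assms by (simp add: m_assoc)
  qed (use assms in simp)
  have "dist (\<phi> h s) (\<phi> ((h \<otimes> g \<otimes> inv h) [^] n) (\<phi> h s)) = dist s (\<phi> (g [^] n) s)" for n :: nat
    unfolding pow using assms by (simp add: act_mult isometric)
  then show ?thesis unfolding linear_growth_def using s by metis
qed

text \<open>A fixed point c would bound every displacement d(s, g^n s) by 2 d(s,c).\<close>

lemma linear_growth_no_fixed_point:
  assumes "linear_growth g" "g \<in> carrier G"
  shows "\<phi> g c \<noteq> c"
proof
  assume fx: "\<phi> g c = c"
  obtain s \<epsilon> where s: "\<epsilon> > 0" "\<And>n::nat. \<epsilon> * real n \<le> dist s (\<phi> (g [^] n) s)"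
    using assms(1) unfolding linear_growth_def by blast
  have fixn: "\<phi> (g [^] n) c = c" for n :: nat
    by (induction n) (use assms fx in \<open>auto simp: act_mult\<close>)
  have bound: "\<epsilon> * real n \<le> 2 * dist s c" for n :: nat
    using s(2)[of n] dist_triangle[of s "\<phi> (g [^] n) s" c] isometric[of "g [^] n" c s] fixn[of n] assms(2)
    by (simp add: dist_commute)
  obtain n :: nat where "2 * dist s c < real n * \<epsilon>" using reals_Archimedean3[OF s(1)] by blast
  with bound[of n] show False by (simp add: mult.commute)
qed

text \<open>The upper bound is the triangle inequality along the orbit. Integer exponents reduce to
  natural ones because d(g^m s, g^n s) depends only on the absolute value of m - n.\<close>

lemma linear_growth_loxodromic:
  assumes "linear_growth g" "g \<in> carrier G"
  shows "loxodromic G \<phi> g"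
proof -
  obtain s \<epsilon> where s: "\<epsilon> > 0" "\<And>n::nat. \<epsilon> * real n \<le> dist s (\<phi> (g [^] n) s)"
    using assms(1) unfolding linear_growth_def by blast
  \<comment> \<open>One constant serves both bounds, with additive constant 0: it is at least 1, the
    displacement of \<open>s\<close>, and 1/\<epsilon>.\<close>
  define L where "L = max 1 (max (dist s (\<phi> g s)) (1 / \<epsilon>))"
  have L: "1 \<le> L" "dist s (\<phi> g s) \<le> L" "1 / \<epsilon> \<le> L" by (auto simp: L_def)
  have upper: "dist s (\<phi> (g [^] n) s) \<le> L * real n" for n :: nat
  proof (induction n)
    case (Suc n)
    have "dist s (\<phi> (g [^] Suc n) s) \<le> dist s (\<phi> (g [^] n) s) + dist (\<phi> (g [^] n) s) (\<phi> (g [^] n) (\<phi> g s))"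
      using assms by (simp add: act_mult dist_triangle)
    then show ?case using Suc L assms by (simp add: isometric field_simps)
  qed simp
  have lower: "real n / L \<le> dist s (\<phi> (g [^] n) s)" for n :: nat
  proof -
    have "1 / L \<le> \<epsilon>" using L s(1) by (simp add: field_simps)
    then have "real n * (1 / L) \<le> real n * \<epsilon>" by (intro mult_left_mono) auto
    then show ?thesis using s(2)[of n] by (simp add: mult.commute)
  qed
  have diff: "dist (\<phi> (g [^] m) s) (\<phi> (g [^] n) s) = dist s (\<phi> (g [^] nat (n - m)) s)" if "m \<le> n" for m n :: int
  proof -
    have "g [^] n = g [^] m \<otimes> g [^] (n - m)"
      using assms by (metis add_diff_cancel_left' int_pow_mult diff_add_cancel add.commute)
    moreover have "g [^] (n - m) = g [^] nat (n - m)"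
      using that by (metis int_pow_int diff_ge_0_iff_ge int_nat_eq)
    ultimately show ?thesis using assms by (simp add: act_mult isometric)
  qed
  have sym: "dist (\<phi> (g [^] m) s) (\<phi> (g [^] n) s) = dist s (\<phi> (g [^] nat \<bar>m - n\<bar>) s)" for m n :: int
    using diff[of m n] diff[of n m] by (cases "m \<le> n") (auto simp: dist_commute)
  have "quasi_isometric_embedding_int (\<lambda>n. \<phi> (g [^] n) s)"
    unfolding quasi_isometric_embedding_int_def
  proof (intro exI conjI allI)
    show "1 \<le> L" "0 \<le> (0::real)" using L by auto
    fix m n :: int
    have "real (nat \<bar>m - n\<bar>) = real_of_int \<bar>m - n\<bar>" by simp
    then have le: "real_of_int \<bar>m - n\<bar> / L \<le> dist s (\<phi> (g [^] nat \<bar>m - n\<bar>) s)"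
      "dist s (\<phi> (g [^] nat \<bar>m - n\<bar>) s) \<le> L * real_of_int \<bar>m - n\<bar>"
      using lower[of "nat \<bar>m - n\<bar>"] upper[of "nat \<bar>m - n\<bar>"] by metis+
    show "real_of_int \<bar>m - n\<bar> / L - 0 \<le> dist (\<phi> (g [^] m) s) (\<phi> (g [^] n) s)"
      and "dist (\<phi> (g [^] m) s) (\<phi> (g [^] n) s) \<le> L * real_of_int \<bar>m - n\<bar> + 0"
      using le unfolding sym[of m n] by simp_all
  qed
  then show ?thesis unfolding loxodromic_def using assms by blast
qed

section \<open>Groups generated by rotations, and the paths of their words\<close>

definition gen :: "'x set \<Rightarrow> 'g set" where
  "gen A = generate G (\<Union>c\<in>A. R c)"

lemma gen_subgroup: "A \<subseteq> C \<Longrightarrow> subgroup (gen A) G"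
  unfolding gen_def using R_carrier by (intro generate_is_subgroup) blast

lemma gen_carrier: "A \<subseteq> C \<Longrightarrow> g \<in> gen A \<Longrightarrow> g \<in> carrier G"
  using gen_subgroup subgroup.mem_carrier by metis

lemma gen_mono: "A \<subseteq> B \<Longrightarrow> gen A \<subseteq> gen B"
  unfolding gen_def by (intro mono_generate) blast

lemma R_subset_gen: "c \<in> A \<Longrightarrow> R c \<subseteq> gen A"
  unfolding gen_def by (auto intro: generate.incl)

lemma gen_minimal: "subgroup K G \<Longrightarrow> (\<And>c. c \<in> A \<Longrightarrow> R c \<subseteq> K) \<Longrightarrow> gen A \<subseteq> K"
  unfolding gen_def by (intro generate_subgroup_incl) auto

lemma conj_eq_one_iff:
  assumes "m \<in> carrier G" "r \<in> carrier G"
  shows "m \<otimes> r \<otimes> inv m = \<one> \<longleftrightarrow> r = \<one>"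
proof
  assume "m \<otimes> r \<otimes> inv m = \<one>"
  then have "m \<otimes> r \<otimes> inv m \<otimes> m = m" using assms by simp
  then have "m \<otimes> r = m" using assms by (simp add: m_assoc)
  then show "r = \<one>" using assms by simp
qed (use assms in simp)

text \<open>Conjugation by m turns a rotation at c into one at m c, so it acts on words letter by
  letter. This is how elements of \<open>gen A\<close> are moved past words of rotations at the
  front.\<close>

lemma word_value_act:
  assumes "A \<subseteq> C" "w \<in> words A R" "m \<in> carrier G"
  shows "word_value G (map (\<lambda>(c, r). (\<phi> m c, m \<otimes> r \<otimes> inv m)) w) = m \<otimes> word_value G w \<otimes> inv m"
  using assms(2)
proof (induction w)
  case Nil
  then show ?case using assms by simp
next
  case (Cons a w)
  obtain c r where a: "a = (c, r)" by force
  have cr: "c \<in> A" "r \<in> R c" "w \<in> words A R" using Cons.prems a by auto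
  have r: "r \<in> carrier G" using cr R_carrier[of c] assms(1) by auto
  have w: "word_value G w \<in> carrier G"
    using word_value_closed[of A R w] R_carrier assms cr by blast
  show ?case using Cons.IH cr a r w assms by (simp add: m_assoc)
qed

lemma words_act:
  assumes "A \<subseteq> C" "m \<in> carrier G" "\<And>c. c \<in> A \<Longrightarrow> \<phi> m c \<in> A" "w \<in> words A R"
  shows "map (\<lambda>(c, r). (\<phi> m c, m \<otimes> r \<otimes> inv m)) w \<in> words A R"
  using assms(4)
proof (induction w)
  case (Cons a w)
  obtain c r where a: "a = (c, r)" by force
  then have "c \<in> A" "r \<in> R c" using Cons.prems by auto
  then show ?case using Cons a assms R_act[of m c] by auto
qed simp

lemma reduced_words_act:
  assumes "A \<subseteq> C" "m \<in> carrier G" "\<And>c. c \<in> A \<Longrightarrow> \<phi> m c \<in> A" "w \<in> reduced_words G A R"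
  shows "map (\<lambda>(c, r). (\<phi> m c, m \<otimes> r \<otimes> inv m)) w \<in> reduced_words G A R"
  using assms(4)
proof (induction w)
  case (Cons a w)
  obtain c r where a: "a = (c, r)" by force
  then have cr: "c \<in> A" "r \<in> R c" "r \<noteq> \<one>" "w \<in> reduced_words G A R" "w \<noteq> [] \<longrightarrow> fst (hd w) \<noteq> c"
    using Cons.prems by (auto simp: reduced_words_Cons)
  have r: "r \<in> carrier G" using cr R_carrier[of c] assms(1) by auto
  have "m \<otimes> r \<otimes> inv m \<noteq> \<one>"
    using conj_eq_one_iff[OF assms(2) r] cr by simp
  moreover have "m \<otimes> r \<otimes> inv m \<in> R (\<phi> m c)" using R_act[of m c] cr assms by auto
  moreover have "fst (hd (map (\<lambda>(c, r). (\<phi> m c, m \<otimes> r \<otimes> inv m)) w)) \<noteq> \<phi> m c" if "w \<noteq> []"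
    using that cr act_eq_iff[OF assms(2)] by (cases w) auto
  ultimately show ?case using Cons.IH cr a assms by (simp add: reduced_words_Cons)
qed simp

lemma last_path_points:
  assumes "A \<subseteq> C" "w \<in> words A R"
  shows "last (path_points \<phi> w v) = \<phi> (word_value G w) v"
  using assms(2)
proof (induction w)
  case (Cons a w)
  obtain c r where a: "a = (c, r)" by force
  have cr: "c \<in> A" "r \<in> R c" "w \<in> words A R" using Cons.prems a by auto
  have "r \<in> carrier G" using cr R_carrier assms by blast
  moreover have "word_value G w \<in> carrier G"
    using word_value_closed[of A R w] R_carrier assms cr by blast
  ultimately show ?case using Cons.IH cr a by (simp add: last_map act_mult)
qed simp

end

section \<open>Windmills\<close>

context rotating_group
begin

text \<open>\<open>S\<close> records the factors: \<open>gen A\<close> is the free product of the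
  rotation groups at \<open>S\<close>, stated as generation together with the triviality of reduced
  words of value one. Keeping \<open>S\<close> explicit lets the factors grow along with
  \<open>A\<close>.\<close>

definition windmill :: "'x set \<Rightarrow> 'x set \<Rightarrow> bool" where
  "windmill A S \<longleftrightarrow> A \<subseteq> C \<and> A \<noteq> {} \<and> S \<subseteq> A \<and>
     (\<forall>g\<in>gen A. \<phi> g ` A \<subseteq> A) \<and>
     (\<forall>c\<in>C - A. \<forall>a\<in>A. \<forall>b\<in>A. 40 * \<delta> \<le> gromov_product a b c) \<and>
     gen A = gen S \<and>
     (\<forall>w\<in>reduced_words G S R. word_value G w = \<one> \<longrightarrow> w = []) \<and>
     (\<forall>g\<in>gen A. (\<exists>c\<in>A. g \<in> R c) \<or> linear_growth g)"

lemma windmillI: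
  assumes "A \<subseteq> C" "A \<noteq> {}" "S \<subseteq> A" "\<And>g a. g \<in> gen A \<Longrightarrow> a \<in> A \<Longrightarrow> \<phi> g a \<in> A"
    and "\<And>a b c. c \<in> C - A \<Longrightarrow> a \<in> A \<Longrightarrow> b \<in> A \<Longrightarrow> 40 * \<delta> \<le> gromov_product a b c"
    and "gen A = gen S"
    and "\<And>w. w \<in> reduced_words G S R \<Longrightarrow> word_value G w = \<one> \<Longrightarrow> w = []"
    and "\<And>g. g \<in> gen A \<Longrightarrow> (\<exists>c\<in>A. g \<in> R c) \<or> linear_growth g"
  shows "windmill A S"
  using assms unfolding windmill_def by auto

end

section \<open>The front of a windmill that misses some apex\<close>

locale proper_windmill = rotating_group G \<phi> \<delta> C R
  for G :: "('g, 'b) monoid_scheme" (structure)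
    and \<phi> :: "'g \<Rightarrow> 'x::metric_space \<Rightarrow> 'x" and \<delta> C R +
  fixes A S :: "'x set"
  assumes windmill: "windmill A S" and proper: "A \<noteq> C"
begin

lemma apex_set: "A \<subseteq> C" "A \<noteq> {}" "S \<subseteq> A"
  and A_act: "g \<in> gen A \<Longrightarrow> a \<in> A \<Longrightarrow> \<phi> g a \<in> A"
  and A_far: "c \<in> C - A \<Longrightarrow> a \<in> A \<Longrightarrow> b \<in> A \<Longrightarrow> 40 * \<delta> \<le> gromov_product a b c"
  and A_gen: "gen A = gen S"
  and S_free: "w \<in> reduced_words G S R \<Longrightarrow> word_value G w = \<one> \<Longrightarrow> w = []"
  and A_dichotomy: "g \<in> gen A \<Longrightarrow> (\<exists>c\<in>A. g \<in> R c) \<or> linear_growth g"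
  using windmill unfolding windmill_def by blast+

text \<open>Since (a|b)_c is roughly the distance from c to a geodesic between a and b, this infimum
  stands for the distance from \<open>A\<close> to the nearest apex outside it.\<close>

definition depth :: real where
  "depth = Inf {gromov_product a b c | a b c. a \<in> A \<and> b \<in> A \<and> c \<in> C - A}"

text \<open>The slack of 20\<delta> makes the front nonempty although the infimum may not be
  attained, and it leaves products of at least 60\<delta> at all other apices outside
  \<open>A\<close>. That surplus pays for the losses on the way back to 40\<delta> in the enlarged
  windmill.\<close>

definition front :: "'x set" where
  "front = {c \<in> C - A. \<exists>a\<in>A. \<exists>b\<in>A. gromov_product a b c \<le> depth + 20 * \<delta>}"

lemma depth_le: "a \<in> A \<Longrightarrow> b \<in> A \<Longrightarrow> c \<in> C - A \<Longrightarrow> depth \<le> gromov_product a b c"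
  unfolding depth_def by (rule cInf_lower) (use A_far in \<open>auto intro!: bdd_belowI\<close>)

lemma depth_ge: "40 * \<delta> \<le> depth"
proof -
  obtain a c where "a \<in> A" "c \<in> C - A" using apex_set proper by blast
  then have "{gromov_product a b c | a b c. a \<in> A \<and> b \<in> A \<and> c \<in> C - A} \<noteq> {}" by blast
  then show ?thesis unfolding depth_def by (rule cInf_greatest) (use A_far in auto)
qed

lemma front_nonempty: "front \<noteq> {}"
proof -
  obtain a c where "a \<in> A" "c \<in> C - A" using apex_set proper by blast
  then have "{gromov_product a b c | a b c. a \<in> A \<and> b \<in> A \<and> c \<in> C - A} \<noteq> {}" by blast
  from cInf_lessD[OF this, of "depth + 20 * \<delta>"] obtain a b c where
    "a \<in> A" "b \<in> A" "c \<in> C - A" "gromov_product a b c < depth + 20 * \<delta>"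
    using pos unfolding depth_def by auto
  then have "c \<in> front" unfolding front_def by (auto intro: less_imp_le)
  then show ?thesis by blast
qed

lemma front_subset: "front \<subseteq> C" "front \<inter> A = {}"
  unfolding front_def by auto

lemma behind_front:
  "c \<in> C - (A \<union> front) \<Longrightarrow> a \<in> A \<Longrightarrow> b \<in> A \<Longrightarrow> 60 * \<delta> \<le> gromov_product a b c"
  unfolding front_def using depth_ge by force

text \<open>The identity (c|a)_c' + (c|b)_c' = d(c,c') + (a|b)_c' - (a|b)_c, applied to a pair a, b
  witnessing that c is in the front, gives a sum of at least 200\<delta> - 20\<delta>. One of the
  two products is at least half of it.\<close>

lemma front_side:
  assumes "c \<in> front" "c' \<in> C - A" "c' \<noteq> c"
  obtains a where "a \<in> A" "90 * \<delta> \<le> gromov_product c a c'"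
proof -
  obtain a b where ab: "a \<in> A" "b \<in> A" "gromov_product a b c \<le> depth + 20 * \<delta>"
    using assms unfolding front_def by blast
  have "depth \<le> gromov_product a b c'" using depth_le ab assms by blast
  moreover have "200 * \<delta> \<le> dist c c'" using apex_dist assms front_subset by blast
  ultimately have "180 * \<delta> \<le> gromov_product c a c' + gromov_product c b c'"
    using ab by (simp add: gromov_product_def dist_commute field_simps)
  then have "90 * \<delta> \<le> gromov_product c a c' \<or> 90 * \<delta> \<le> gromov_product c b c'" by linarith
  then show ?thesis using that ab by blast
qed

lemma front_inner:
  assumes "c \<in> front" "c' \<in> C - A" "c' \<noteq> c" "v \<in> A" "M \<le> 90 * \<delta>"
    and "\<And>a b. a \<in> A \<Longrightarrow> b \<in> A \<Longrightarrow> M \<le> gromov_product a b c'"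
  shows "M - \<delta> \<le> gromov_product c v c'"
proof -
  obtain a where a: "a \<in> A" "90 * \<delta> \<le> gromov_product c a c'" using front_side assms by blast
  then show ?thesis using four_point[of c a c' v] assms(6)[OF a(1) assms(4)] assms(5) by linarith
qed

text \<open>A point of the front is replaced by a point of \<open>A\<close> in nearly the same
  direction from c, at the cost of one \<delta>; this happens at most twice. It is used with M =
  40\<delta> at the front and with M = 60\<delta> behind it.\<close>

lemma outside_product:
  assumes "u \<in> A \<union> front" "v \<in> A \<union> front" "c \<in> C - A" "u \<noteq> c" "v \<noteq> c" "M \<le> 90 * \<delta>"
    and M: "\<And>a b. a \<in> A \<Longrightarrow> b \<in> A \<Longrightarrow> M \<le> gromov_product a b c"
  shows "M - 2 * \<delta> \<le> gromov_product u v c"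
proof -
  note inner = front_inner[OF _ assms(3) _ _ assms(6) M]
  consider "u \<in> A" "v \<in> A" | "u \<in> A" "v \<in> front" | "u \<in> front" "v \<in> A" | "u \<in> front" "v \<in> front"
    using assms by blast
  then show ?thesis
  proof cases
    case 1
    then show ?thesis using M[of u v] pos by auto
  next
    case 2
    then show ?thesis using inner[of v u] assms(5) pos by (auto simp: gromov_product_commute)
  next
    case 3
    then show ?thesis using inner[of u v] assms(4) pos by auto
  next
    case 4
    obtain a where a: "a \<in> A" "90 * \<delta> \<le> gromov_product u a c"
      using front_side[of u c] 4 assms by blast
    have "M - \<delta> \<le> gromov_product v a c" using inner[of v a] 4 a assms(5) by auto
    then show ?thesis using four_point[of u a c v] a(2) assms(6) pos
      by (auto simp: gromov_product_commute[of v a] min_def split: if_splits)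
  qed
qed

lemma gen_A_carrier: "m \<in> gen A \<Longrightarrow> m \<in> carrier G"
  using gen_carrier apex_set by blast

lemma front_act:
  assumes m: "m \<in> gen A" and c: "c \<in> front"
  shows "\<phi> m c \<in> front"
proof -
  have mc: "m \<in> carrier G" using gen_A_carrier m .
  have im: "inv m \<in> gen A" using subgroup.m_inv_closed[OF gen_subgroup[OF apex_set(1)] m] .
  obtain a b where ab: "a \<in> A" "b \<in> A" "gromov_product a b c \<le> depth + 20 * \<delta>" "c \<in> C - A"
    using c unfolding front_def by blast
  have "\<phi> m c \<notin> A" using A_act[OF im, of "\<phi> m c"] ab mc by auto
  moreover have "\<phi> m c \<in> C" using apex_act mc ab by blast
  moreover have "\<phi> m a \<in> A" "\<phi> m b \<in> A" using A_act m ab by auto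
  moreover have "gromov_product (\<phi> m a) (\<phi> m b) (\<phi> m c) = gromov_product a b c"
    using gromov_product_act mc by blast
  moreover from calculation(3-5) have "\<exists>a\<in>A. \<exists>b\<in>A. gromov_product a b (\<phi> m c) \<le> depth + 20 * \<delta>"
    using ab by (intro bexI[of _ "\<phi> m a"] bexI[of _ "\<phi> m b"]) simp_all
  ultimately show ?thesis unfolding front_def by blast
qed

text \<open>An element with a fixed point has no linear growth, so by the dichotomy it is a rotation
  at an apex of \<open>A\<close>; a nontrivial one would fix no second apex.\<close>

lemma gen_A_free_outside:
  assumes "m \<in> gen A" "c \<in> C - A" "\<phi> m c = c"
  shows "m = \<one>"
proof (rule ccontr)
  assume "m \<noteq> \<one>"
  have "\<not> linear_growth m"
    using linear_growth_no_fixed_point[OF _ gen_A_carrier[OF assms(1)], of c] assms(3) by blast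
  then obtain a where a: "a \<in> A" "m \<in> R a" using A_dichotomy[OF assms(1)] by blast
  then have "c = a" using rotation_fixes_one_apex[of a c m] \<open>m \<noteq> \<one>\<close> assms apex_set(1) by auto
  then show False using a assms by simp
qed

section \<open>Words of rotations at the front\<close>

lemma front_words_carrier: "w \<in> words front R \<Longrightarrow> word_value G w \<in> carrier G"
  using word_value_closed[of front R w] R_carrier front_subset by blast

lemma front_word_append:
  "v \<in> words front R \<Longrightarrow> w \<in> words front R \<Longrightarrow> word_value G (v @ w) = word_value G v \<otimes> word_value G w"
  using word_value_append[of front R v w] R_carrier front_subset by blast

lemma front_reduced_carrier: "w \<in> reduced_words G front R \<Longrightarrow> word_value G w \<in> carrier G"
  using front_words_carrier reduced_words_subset by blast

lemma front_product:
  assumes "u \<in> A \<union> front" "v \<in> A \<union> front" "c \<in> front" "u \<noteq> c" "v \<noteq> c"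
  shows "38 * \<delta> \<le> gromov_product u v c"
  using outside_product[of u v c "40 * \<delta>"] assms A_far[of c] front_subset pos by fastforce

text \<open>Before rotating, the vertices before and after c have product at least 38\<delta> at c,
  so the segments are long and the rotation at c makes the turn small. The assumptions on
  \<open>x\<close> and \<open>v\<close> exclude degenerate first and last segments.\<close>

lemma taut_path_points:
  assumes "w \<in> reduced_words G front R" "w \<noteq> []" "x \<in> A \<union> front" "x \<noteq> fst (hd w)"
    "v \<in> A \<union> front" "v \<noteq> fst (last w)"
  shows "taut \<delta> (x # path_points \<phi> w v)"
  using assms
proof (induction w arbitrary: x)
  case (Cons a w)
  obtain c r where a: "a = (c, r)" by force
  have cr: "c \<in> front" "r \<in> R c" "r \<noteq> \<one>" "w \<in> reduced_words G front R" "w \<noteq> [] \<longrightarrow> fst (hd w) \<noteq> c"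
    using Cons.prems a by (auto simp: reduced_words_Cons)
  have cC: "c \<in> C" using cr front_subset by blast
  have rc: "r \<in> carrier G" using R_carrier cr cC by blast
  have fx: "\<phi> r c = c" using R_fix cr cC by blast
  have xc: "x \<noteq> c" using Cons.prems a by simp
  \<comment> \<open>The vertex after \<open>c\<close> before \<open>r\<close> is applied: the next
    apex of the word, or \<open>v\<close> if there is none.\<close>
  define y where "y = hd (path_points \<phi> w v)"
  have y: "y \<in> A \<union> front" "y \<noteq> c"
    using Cons.prems cr a unfolding y_def by (cases w; force simp: reduced_words_Cons)+
  have p: "38 * \<delta> \<le> gromov_product x y c" using front_product Cons.prems y cr xc by blast
  have dx: "20 * \<delta> \<le> dist x c" and dy: "20 * \<delta> \<le> dist c y"
    using p gromov_product_le_dist[of x y c] pos by (auto simp: dist_commute)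
  have turn: "gromov_product x (\<phi> r y) c \<le> \<delta> / 2"
    using rotation_turn[OF cC cr(2,3), of x y] p pos by simp
  have "taut \<delta> (c # path_points \<phi> w v)"
  proof (cases "w = []")
    case True
    then show ?thesis using dy by (simp add: y_def)
  next
    case False
    then show ?thesis using Cons.IH[of c] Cons.prems cr a by auto
  qed
  then have "taut \<delta> (map (\<phi> r) (c # path_points \<phi> w v))" using taut_map_act rc by blast
  then have "taut \<delta> (c # map (\<phi> r) (path_points \<phi> w v))" using fx by simp
  then show ?case using a dx turn by (simp add: hd_map y_def)
qed simp

lemma front_turns:
  assumes "w \<in> reduced_words G front R" "w \<noteq> []" "x \<in> A \<union> front" "x \<noteq> fst (hd w)"
    "v \<in> A \<union> front" "v \<noteq> fst (last w)" "p \<in> set (butlast (path_points \<phi> w v))"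
  shows "gromov_product x (\<phi> (word_value G w) v) p \<le> 5/2 * \<delta>"
  using taut_all_turns[OF taut_path_points[OF assms(1-6)] assms(7)]
    last_path_points[OF front_subset(1), of w v] assms(1) reduced_words_subset[of front R] by (metis subsetD)

text \<open>Otherwise a point of \<open>A\<close> and its image both lie in \<open>A\<close>, so
  their product at the first apex of w is at least 40\<delta>; but the path of w passes that apex
  with a turn of at most 5/2 * \<delta>.\<close>

lemma front_word_notin_gen_A:
  assumes w: "w \<in> reduced_words G front R" "w \<noteq> []"
  shows "word_value G w \<notin> gen A"
proof
  assume g: "word_value G w \<in> gen A"
  obtain a where a: "a \<in> A" using apex_set by blast
  have "fst (hd w) \<in> front" "fst (last w) \<in> front"
    using w unfolding reduced_words_def by (auto simp: case_prod_unfold)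
  then have f: "fst (hd w) \<in> C - A" "fst (last w) \<in> C - A" using front_subset by auto
  then have "gromov_product a (\<phi> (word_value G w) a) (fst (hd w)) \<le> 5/2 * \<delta>"
    using front_turns[OF w, of a a] a hd_in_butlast_path_points[OF w(2)] by auto
  moreover have "40 * \<delta> \<le> gromov_product a (\<phi> (word_value G w) a) (fst (hd w))"
    using A_far f A_act g a by blast
  ultimately show False using pos by linarith
qed

section \<open>The enlarged set of apices\<close>

text \<open>This orbit becomes the set of apices of the next windmill; taking the whole orbit makes
  invariance immediate.\<close>

definition hub :: "'x set" where
  "hub = {\<phi> g u | g u. g \<in> gen (A \<union> front) \<and> u \<in> A \<union> front}"

lemma union_subset: "A \<union> front \<subseteq> C"
  using apex_set front_subset by blast

lemma gen_union_carrier: "g \<in> gen (A \<union> front) \<Longrightarrow> g \<in> carrier G"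
  using gen_carrier union_subset by blast

lemma gen_union_subgroup: "subgroup (gen (A \<union> front)) G"
  using gen_subgroup union_subset by blast

lemma hub_act:
  assumes "g \<in> gen (A \<union> front)" "u \<in> hub"
  shows "\<phi> g u \<in> hub"
proof -
  obtain h v where h: "h \<in> gen (A \<union> front)" "v \<in> A \<union> front" "u = \<phi> h v"
    using assms unfolding hub_def by blast
  then have "\<phi> g u = \<phi> (g \<otimes> h) v" using assms gen_union_carrier by (simp add: act_mult)
  then show ?thesis unfolding hub_def using h assms subgroup.m_closed[OF gen_union_subgroup] by blast
qed

lemma union_subset_hub: "A \<union> front \<subseteq> hub"
proof
  fix u assume "u \<in> A \<union> front"
  moreover have "u = \<phi> \<one> u" by simp
  ultimately show "u \<in> hub" unfolding hub_def using subgroup.one_closed[OF gen_union_subgroup] by blast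
qed

lemma hub_subset: "hub \<subseteq> C"
  unfolding hub_def using apex_act gen_union_carrier union_subset by blast

lemma hub_act_inv:
  assumes "g \<in> gen (A \<union> front)" "c \<in> C - hub"
  shows "\<phi> (inv g) c \<in> C - hub"
proof -
  have g: "g \<in> carrier G" using gen_union_carrier assms by blast
  have "\<phi> (inv g) c \<in> C" using apex_act g assms by simp
  moreover have "\<phi> (inv g) c \<notin> hub" using hub_act[OF assms(1), of "\<phi> (inv g) c"] g assms by auto
  ultimately show ?thesis by blast
qed

lemma R_front_gen: "c \<in> front \<Longrightarrow> r \<in> R c \<Longrightarrow> r \<in> gen (A \<union> front)"
  using R_subset_gen by blast

text \<open>Each segment is a translate of one between points of \<open>A\<close> and the front.
  Pulling \<open>c\<close> back by the rotation keeps it outside the hub, where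
  \<open>outside_product\<close> gives 60\<delta> - 2\<delta>.\<close>

lemma segment_products:
  assumes "w \<in> words front R" "x \<in> A \<union> front" "v \<in> A \<union> front" "c \<in> C - hub"
  shows "successively (\<lambda>u v. 58 * \<delta> \<le> gromov_product u v c) (x # path_points \<phi> w v)"
  using assms
proof (induction w arbitrary: x c)
  case Nil
  have "58 * \<delta> \<le> gromov_product x v c"
    using outside_product[of x v c "60 * \<delta>"] Nil behind_front[of c] union_subset_hub pos by fastforce
  then show ?case by simp
next
  case (Cons a w)
  obtain d r where a: "a = (d, r)" by force
  have d: "d \<in> front" "r \<in> R d" "w \<in> words front R" using Cons.prems a by auto
  have dC: "d \<in> C" using d front_subset by blast
  have rc: "r \<in> carrier G" using R_carrier d dC by blast
  have "58 * \<delta> \<le> gromov_product x d c"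
    using outside_product[of x d c "60 * \<delta>"] Cons.prems behind_front[of c] union_subset_hub d pos by fastforce
  moreover have "\<phi> (inv r) c \<in> C - hub" using hub_act_inv R_front_gen d Cons.prems by blast
  then have "successively (\<lambda>u v. 58 * \<delta> \<le> gromov_product u v (\<phi> (inv r) c)) (d # path_points \<phi> w v)"
    using Cons.IH[of d "\<phi> (inv r) c"] d Cons.prems by blast
  then have "successively (\<lambda>u v. 58 * \<delta> \<le> gromov_product u v c) (map (\<phi> r) (d # path_points \<phi> w v))"
    unfolding successively_map gromov_product_act_inv[OF rc] .
  then have "successively (\<lambda>u v. 58 * \<delta> \<le> gromov_product u v c) (d # map (\<phi> r) (path_points \<phi> w v))"
    using R_fix[OF dC d(2)] by simp
  ultimately show ?case using a by simp
qed

text \<open>If \<open>x\<close> and \<open>v\<close> differ from the end apices of the word, the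
  path is taut and 58\<delta> - 7\<delta> remains. If \<open>x\<close> is the first apex, pulling
  back by the first rotation, which fixes it, shortens the word; if \<open>v\<close> is the last
  apex, the last letter acts trivially on it and is dropped.\<close>

lemma word_far_from_outside:
  assumes "w \<in> reduced_words G front R" "x \<in> A \<union> front" "v \<in> A \<union> front" "c \<in> C - hub"
  shows "40 * \<delta> \<le> gromov_product x (\<phi> (word_value G w) v) c"
  using assms
proof (induction "length w" arbitrary: w x v c rule: less_induct)
  case less
  have W: "w \<in> words front R" using less.prems reduced_words_subset by blast
  show ?case
  proof (cases "w = []")
    case True
    then show ?thesis using segment_products[OF W less.prems(2-4)] pos by simp
  next
    case ne: False
    then obtain d r w' where w: "w = (d, r) # w'" by (cases w) auto
    have d: "d \<in> front" "r \<in> R d" "w' \<in> reduced_words G front R"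
      using less.prems w by (auto simp: reduced_words_Cons)
    have dC: "d \<in> C" using d front_subset by blast
    have rc: "r \<in> carrier G" using R_carrier d dC by blast
    consider "x = d" | "v = fst (last w)" | "x \<noteq> fst (hd w)" "v \<noteq> fst (last w)" using w by auto
    then show ?thesis
    proof cases
      case 1
      have "40 * \<delta> \<le> gromov_product d (\<phi> (word_value G w') v) (\<phi> (inv r) c)"
        using less.hyps[of w' d v "\<phi> (inv r) c"] d w less.prems hub_act_inv R_front_gen by simp
      also have "\<dots> = gromov_product (\<phi> r d) (\<phi> r (\<phi> (word_value G w') v)) c"
        using gromov_product_act_inv[OF rc] by simp
      finally show ?thesis using 1 w R_fix[OF dC d(2)] rc front_reduced_carrier[OF d(3)]
        by (simp add: act_mult)
    next
      case 2
      define u where "u = butlast w"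
      obtain e s where w2: "w = u @ [(e, s)]" using ne unfolding u_def by (metis append_butlast_last_id surj_pair)
      have e: "e \<in> front" "s \<in> R e" "u \<in> reduced_words G front R"
        using less.prems(1) unfolding w2 by (auto simp: reduced_words_append reduced_words_Cons)
      have eC: "e \<in> C" using e front_subset by blast
      have sc: "s \<in> carrier G" using R_carrier e eC by blast
      have "word_value G w = word_value G u \<otimes> s"
        unfolding w2 using front_word_append[of u "[(e, s)]"] e reduced_words_subset[of front R] sc
        by (simp add: subset_iff)
      then have "\<phi> (word_value G w) v = \<phi> (word_value G u) v"
        using 2 w2 sc R_fix[OF eC e(2)] front_reduced_carrier[OF e(3)] by (simp add: act_mult)
      then show ?thesis using less.hyps[of u x v c] w2 e less.prems by simp
    next
      case 3
      let ?P = "path_points \<phi> w v"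
      have last: "last ?P = \<phi> (word_value G w) v" using last_path_points[OF front_subset(1) W] .
      have "successively (\<lambda>u v. 58 * \<delta> \<le> gromov_product u v c) (x # butlast ?P @ [last ?P])"
        using segment_products[OF W less.prems(2-4)] by simp
      then have "58 * \<delta> - 7 * \<delta> \<le> gromov_product x (last ?P) c"
        using front_turns[OF less.prems(1) ne less.prems(2) 3(1) less.prems(3) 3(2)]
        by (intro gromov_product_along_path[of "butlast ?P"]) (simp_all add: last)
      then show ?thesis using last pos by simp
    qed
  qed
qed

text \<open>Elements of \<open>gen A\<close> are collected on the right. Moving one past a front
  word conjugates the letters, and they remain rotations at the front because \<open>gen A\<close>
  preserves it.\<close>

lemma gen_union_decomposition:
  assumes "g \<in> gen (A \<union> front)"
  obtains w m where "w \<in> reduced_words G front R" "m \<in> gen A" "g = word_value G w \<otimes> m"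
proof -
  have front_sub: "subgroup (R c) G" if "c \<in> front" for c using R_subgroup that front_subset by blast
  note subA = gen_subgroup[OF apex_set(1)]
  have letter: "\<exists>w\<in>words front R. \<exists>m\<in>gen A. r = word_value G w \<otimes> m" if c: "c \<in> A \<union> front" "r \<in> R c" for r c
  proof -
    have r: "r \<in> carrier G" using c R_carrier union_subset by blast
    show ?thesis
    proof (cases "c \<in> A")
      case True
      then have "r \<in> gen A" using R_subset_gen c by blast
      then show ?thesis using r by (intro bexI[of _ "[]"] bexI[of _ r]) auto
    next
      case False
      then show ?thesis using r c subgroup.one_closed[OF subA]
        by (intro bexI[of _ "[(c, r)]"] bexI[of _ \<one>]) auto
    qed
  qed
  have "\<exists>w\<in>words front R. \<exists>m\<in>gen A. g = word_value G w \<otimes> m"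
    using assms unfolding gen_def[of "A \<union> front"]
  proof induction
    case one
    then show ?case using subgroup.one_closed[OF subA] by (intro bexI[of _ "[]"] bexI[of _ \<one>]) auto
  next
    case (incl h)
    then show ?case using letter by blast
  next
    case (inv h)
    then obtain c where "c \<in> A \<union> front" "h \<in> R c" by blast
    then show ?case using letter[of c "inv h"] subgroup.m_inv_closed[OF R_subgroup[of c]] union_subset by auto
  next
    case (eng h1 h2)
    then obtain w1 m1 w2 m2 where 1: "w1 \<in> words front R" "m1 \<in> gen A" "h1 = word_value G w1 \<otimes> m1"
      and 2: "w2 \<in> words front R" "m2 \<in> gen A" "h2 = word_value G w2 \<otimes> m2" by blast
    let ?w = "map (\<lambda>(c, r). (\<phi> m1 c, m1 \<otimes> r \<otimes> inv m1)) w2"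
    have m: "m1 \<in> carrier G" "m2 \<in> carrier G" using 1 2 gen_A_carrier by auto
    have w: "?w \<in> words front R" using words_act[OF front_subset(1) m(1) _ 2(1)] front_act 1 by blast
    have "word_value G (w1 @ ?w) = word_value G w1 \<otimes> (m1 \<otimes> word_value G w2 \<otimes> inv m1)"
      using front_word_append[OF 1(1) w] word_value_act[OF front_subset(1) 2(1) m(1)] by simp
    then have "h1 \<otimes> h2 = word_value G (w1 @ ?w) \<otimes> (m1 \<otimes> m2)"
      using 1 2 m front_words_carrier by (simp add: m_assoc)
    then show ?case using w 1 2 subgroup.m_closed[OF subA]
      by (intro bexI[of _ "w1 @ ?w"] bexI[of _ "m1 \<otimes> m2"]) auto
  qed
  then obtain w m where w: "w \<in> words front R" "m \<in> gen A" "g = word_value G w \<otimes> m" by blast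
  have "\<exists>w'\<in>reduced_words G front R. word_value G w' = word_value G w \<and> length w' \<le> length w"
    by (intro exists_reduced_word front_sub w(1))
  then show ?thesis using that w by metis
qed

text \<open>Translating by the inverse of g puts the first point into \<open>A\<close> or the front.
  The trailing factor m in the decomposition of the relative element preserves both sets, so only a
  front word remains.\<close>

lemma hub_far:
  assumes "a \<in> hub" "b \<in> hub" "c \<in> C - hub"
  shows "40 * \<delta> \<le> gromov_product a b c"
proof -
  obtain g u where g: "g \<in> gen (A \<union> front)" "u \<in> A \<union> front" "a = \<phi> g u"
    using assms unfolding hub_def by blast
  obtain h v where h: "h \<in> gen (A \<union> front)" "v \<in> A \<union> front" "b = \<phi> h v"
    using assms unfolding hub_def by blast
  have gc: "g \<in> carrier G" "h \<in> carrier G" using g h gen_union_carrier by auto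
  have "inv g \<otimes> h \<in> gen (A \<union> front)"
    using g h subgroup.m_closed[OF gen_union_subgroup] subgroup.m_inv_closed[OF gen_union_subgroup] by simp
  then obtain w m where w: "w \<in> reduced_words G front R" "m \<in> gen A" "inv g \<otimes> h = word_value G w \<otimes> m"
    using gen_union_decomposition by blast
  have mv: "\<phi> m v \<in> A \<union> front" using A_act front_act w h by blast
  have "h = g \<otimes> (word_value G w \<otimes> m)" using gc by (simp flip: w(3))
  then have "b = \<phi> g (\<phi> (word_value G w) (\<phi> m v))"
    using h gc w gen_A_carrier front_reduced_carrier by (simp add: act_mult)
  then have "gromov_product a b c = gromov_product u (\<phi> (word_value G w) (\<phi> m v)) (\<phi> (inv g) c)"
    using g gromov_product_act_inv[OF gc(1)] by simp
  then show ?thesis using word_far_from_outside[OF w(1) g(2) mv] hub_act_inv[OF g(1) assms(3)] by simp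
qed

lemma gen_hub: "gen hub = gen (A \<union> front)"
proof
  show "gen (A \<union> front) \<subseteq> gen hub" using gen_mono union_subset_hub .
  have "R c \<subseteq> gen (A \<union> front)" if c: "c \<in> hub" for c
  proof -
    obtain g u where g: "g \<in> gen (A \<union> front)" "u \<in> A \<union> front" "c = \<phi> g u"
      using c unfolding hub_def by blast
    have "R c = (\<lambda>r. g \<otimes> r \<otimes> inv g) ` R u" using R_act[of g u] g gen_union_carrier union_subset by auto
    moreover have "R u \<subseteq> gen (A \<union> front)" using R_subset_gen g by blast
    ultimately show ?thesis
      using g gen_union_subgroup subgroup.m_closed[OF gen_union_subgroup] subgroup.m_inv_closed[OF gen_union_subgroup]
      by (auto simp: subset_iff)
  qed
  then show "gen hub \<subseteq> gen (A \<union> front)" using gen_minimal gen_union_subgroup by blast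
qed

section \<open>Powers and the dichotomy in the enlarged group\<close>

text \<open>The n-th power is w, then its conjugates by m, m^2, ..., followed by m^n. The hypothesis
  \<open>turn\<close> says that nothing merges at the junctions; the first apex is carried through
  the induction to check this.\<close>

lemma front_word_power:
  assumes w: "w \<in> reduced_words G front R" "w \<noteq> []" and m: "m \<in> gen A"
    and turn: "fst (last w) \<noteq> \<phi> m (fst (hd w))"
  shows "\<exists>w'\<in>reduced_words G front R. length w' = n * length w \<and> (w' \<noteq> [] \<longrightarrow> fst (hd w') = fst (hd w)) \<and>
    (word_value G w \<otimes> m) [^] n = word_value G w' \<otimes> m [^] n"
proof (induction n)
  case 0
  then show ?case by (intro bexI[of _ "[]"]) auto
next
  case (Suc n)
  then obtain w' where w': "w' \<in> reduced_words G front R" "length w' = n * length w"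
    "w' \<noteq> [] \<longrightarrow> fst (hd w') = fst (hd w)" "(word_value G w \<otimes> m) [^] n = word_value G w' \<otimes> m [^] n"
    by blast
  let ?v = "map (\<lambda>(c, r). (\<phi> m c, m \<otimes> r \<otimes> inv m)) w'"
  have mc: "m \<in> carrier G" using gen_A_carrier m .
  note wc = front_reduced_carrier[OF w(1)] front_reduced_carrier[OF w'(1)]
  have v: "?v \<in> reduced_words G front R"
    using reduced_words_act[OF front_subset(1) mc _ w'(1)] front_act m by blast
  have "fst (hd ?v) = \<phi> m (fst (hd w))" if "w' \<noteq> []" using that w'(3) by (cases w') auto
  then have red: "w @ ?v \<in> reduced_words G front R"
    using v w turn unfolding reduced_words_append by auto
  have "word_value G (w @ ?v) = word_value G w \<otimes> (m \<otimes> word_value G w' \<otimes> inv m)"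
    using front_word_append[of w ?v] word_value_act[OF front_subset(1) _ mc, of w'] v w w'
      subsetD[OF reduced_words_subset[of front R]] by simp
  moreover have "(word_value G w \<otimes> m) [^] Suc n = (word_value G w \<otimes> m) \<otimes> (word_value G w' \<otimes> m [^] n)"
    using wc mc by (simp only: nat_pow_Suc2 m_closed w'(4))
  moreover have "m [^] Suc n = m \<otimes> m [^] n" using mc by (simp only: nat_pow_Suc2)
  ultimately have "(word_value G w \<otimes> m) [^] Suc n = word_value G (w @ ?v) \<otimes> m [^] Suc n"
    using wc mc by (simp add: m_assoc)
  then show ?case using red w'(2) w(2) by (intro bexI[of _ "w @ ?v"]) auto
qed

text \<open>The word of the n-th power has at least n letters, and its path from a to the image of
  m^n a is taut because m^n a is still in \<open>A\<close>; \<open>taut_length\<close> gives the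
  growth.\<close>

lemma front_word_linear_growth:
  assumes w: "w \<in> reduced_words G front R" "w \<noteq> []" and m: "m \<in> gen A"
    and turn: "fst (last w) \<noteq> \<phi> m (fst (hd w))"
  shows "linear_growth (word_value G w \<otimes> m)"
proof -
  obtain a where a: "a \<in> A" using apex_set by blast
  have mc: "m \<in> carrier G" using gen_A_carrier m .
  have "\<delta> * real n \<le> dist a (\<phi> ((word_value G w \<otimes> m) [^] n) a)" for n :: nat
  proof (cases "n = 0")
    case False
    obtain w' where w': "w' \<in> reduced_words G front R" "length w' = n * length w"
      "(word_value G w \<otimes> m) [^] n = word_value G w' \<otimes> m [^] n"
      using front_word_power[OF assms] by blast
    have ne: "w' \<noteq> []" using w' w False by auto
    have "n * 1 \<le> n * length w" using w(2) by (intro mult_le_mono2) (simp add: Suc_leI)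
    then have n: "n \<le> length w'" using w'(2) by simp
    have mn: "m [^] n \<in> gen A"
    proof (induction n)
      case 0
      show ?case using subgroup.one_closed[OF gen_subgroup[OF apex_set(1)]] by simp
    next
      case (Suc n)
      then show ?case using subgroup.m_closed[OF gen_subgroup[OF apex_set(1)] _ m] by simp
    qed
    define b where "b = \<phi> (m [^] n) a"
    have b: "b \<in> A" unfolding b_def using A_act mn a by blast
    have f: "fst (hd w') \<in> front" "fst (last w') \<in> front"
      using w' ne unfolding reduced_words_def by (auto simp: case_prod_unfold)
    have "taut \<delta> (a # path_points \<phi> w' b)"
      using taut_path_points[OF w'(1) ne, of a b] a b f front_subset by blast
    from taut_length[OF this] have "17 * \<delta> * real (Suc (length w')) \<le> dist a (\<phi> (word_value G w') b)"
      using last_path_points[OF front_subset(1), of w' b] w'(1) subsetD[OF reduced_words_subset[of front R]] by simp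
    moreover have "\<phi> (word_value G w') b = \<phi> ((word_value G w \<otimes> m) [^] n) a"
      unfolding w'(3) b_def using mc front_reduced_carrier[OF w'(1)] by (simp add: act_mult)
    moreover have "\<delta> * real n \<le> 17 * \<delta> * real (Suc (length w'))"
      using n pos by (intro mult_mono) auto
    ultimately show ?thesis by simp
  qed simp
  then show ?thesis unfolding linear_growth_def using pos by blast
qed

lemma hub_dichotomy_conj:
  assumes g: "g \<in> gen (A \<union> front)" and h: "h \<in> gen (A \<union> front)"
    and dich: "(\<exists>c\<in>hub. g \<in> R c) \<or> linear_growth g"
  shows "(\<exists>c\<in>hub. h \<otimes> g \<otimes> inv h \<in> R c) \<or> linear_growth (h \<otimes> g \<otimes> inv h)"
proof -
  have c: "g \<in> carrier G" "h \<in> carrier G" using g h gen_union_carrier by auto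
  show ?thesis
  proof (cases "linear_growth g")
    case True
    then show ?thesis using linear_growth_conj c by blast
  next
    case False
    then obtain d where d: "d \<in> hub" "g \<in> R d" using dich by blast
    then have "h \<otimes> g \<otimes> inv h \<in> R (\<phi> h d)" using R_act[of h d] c hub_subset by blast
    then show ?thesis using hub_act[OF h d(1)] by blast
  qed
qed

lemma gen_A_subset: "gen A \<subseteq> gen (A \<union> front)"
  by (intro gen_mono) blast

lemma front_words_gen: "w \<in> words front R \<Longrightarrow> word_value G w \<in> gen (A \<union> front)"
  using word_value_in_generate[of w front R] gen_mono[of front "A \<union> front"] unfolding gen_def by blast

text \<open>A word whose last apex is the image under \<open>m\<close> of its first one becomes shorter after
  conjugation by its first letter; all other words trace out a quasi-geodesic axis.\<close>

lemma hub_dichotomy_word: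
  assumes "w \<in> reduced_words G front R" "m \<in> gen A"
  shows "(\<exists>c\<in>hub. word_value G w \<otimes> m \<in> R c) \<or> linear_growth (word_value G w \<otimes> m)"
  using assms
proof (induction "length w" arbitrary: w rule: less_induct)
  case less
  have mc: "m \<in> carrier G" using gen_A_carrier less.prems by blast
  have mU: "m \<in> gen (A \<union> front)" using less.prems gen_A_subset by blast
  show ?case
  proof (cases "w = []")
    case True
    then show ?thesis using A_dichotomy[OF less.prems(2)] union_subset_hub mc by auto
  next
    case False
    then obtain c r w' where w: "w = (c, r) # w'" by (cases w) auto
    have c: "c \<in> front" "r \<in> R c" "r \<noteq> \<one>" "w' \<in> reduced_words G front R"
      using less.prems(1) w by (auto simp: reduced_words_Cons)
    have cC: "c \<in> C" using c front_subset by blast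
    have rc: "r \<in> carrier G" using R_carrier cC c by blast
    show ?thesis
    proof (cases "fst (last w) = \<phi> m c")
      case False
      then show ?thesis using front_word_linear_growth[OF less.prems(1) \<open>w \<noteq> []\<close> less.prems(2)] w by simp
    next
      case turn: True
      show ?thesis
      proof (cases "w' = []")
        case True
        then have "\<phi> m c = c" using turn w by simp
        \<comment> \<open>With a single letter, the turn condition says that \<open>m\<close> fixes
          an apex of the front; the product is then just the rotation \<open>r\<close>.\<close>
        then have "m = \<one>" using gen_A_free_outside[OF less.prems(2), of c] c front_subset by blast
        then show ?thesis using c w True rc union_subset_hub by auto
      next
        case False
        define u where "u = butlast w'"
        obtain d s where w2: "w' = u @ [(d, s)]" using False unfolding u_def by (metis append_butlast_last_id surj_pair)
        have d: "d = \<phi> m c" using turn w w2 by simp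
        have "(d, s) # [] \<in> reduced_words G front R" "u \<in> reduced_words G front R"
          using c(4) unfolding w2 reduced_words_append by auto
        then have ds: "d \<in> front" "s \<in> R d" by (auto simp: reduced_words_Cons)
        have u: "u \<in> words front R" using \<open>u \<in> reduced_words G front R\<close> reduced_words_subset by blast
        have dC: "d \<in> C" using ds front_subset by blast
        have sc: "s \<in> carrier G" using R_carrier dC ds by blast
        \<comment> \<open>As d = m c, this conjugate is a rotation at d. Conjugating away the first
          letter r moves it behind m, that is u s m r = u (s t) m, and t merges with the last letter
          s.\<close>
        define t where "t = m \<otimes> r \<otimes> inv m"
        have tR: "t \<in> R d" unfolding d t_def using R_act[OF mc cC] c by blast
        have tc: "t \<in> carrier G" using R_carrier dC tR by blast
        have st: "s \<otimes> t \<in> R d" using subgroup.m_closed[OF R_subgroup[OF dC] ds(2) tR] .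
        define v where "v = u @ [(d, s \<otimes> t)]"
        have v: "v \<in> words front R" unfolding v_def using u st ds by simp
        have front_sub: "subgroup (R c) G" if "c \<in> front" for c using R_subgroup that front_subset by blast
        have "\<exists>v'\<in>reduced_words G front R. word_value G v' = word_value G v \<and> length v' \<le> length v"
          by (intro exists_reduced_word front_sub v)
        then obtain v' where v': "v' \<in> reduced_words G front R" "word_value G v' = word_value G v" "length v' \<le> length v"
          by blast
        have len: "length v' < length w" using v' unfolding v_def w w2 by simp
        have uc: "word_value G u \<in> carrier G" using front_words_carrier u .
        have val_v: "word_value G v = word_value G u \<otimes> (s \<otimes> t)"
          unfolding v_def using front_word_append[of u "[(d, s \<otimes> t)]"] u st ds sc tc by simp
        have val_w: "word_value G w = r \<otimes> (word_value G u \<otimes> s)"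
          unfolding w w2 using front_word_append[of u "[(d, s)]"] u ds sc by simp
        have "word_value G w \<otimes> m = r \<otimes> (word_value G v' \<otimes> m) \<otimes> inv r"
          unfolding v'(2) val_v val_w t_def using rc uc sc mc by (simp add: m_assoc)
        moreover have "word_value G v' \<otimes> m \<in> gen (A \<union> front)"
          using subgroup.m_closed[OF gen_union_subgroup _ mU] front_words_gen v'(1) reduced_words_subset by blast
        ultimately show ?thesis
          using hub_dichotomy_conj[OF _ R_front_gen[OF c(1,2)]] less.hyps[OF len v'(1) less.prems(2)] by simp
      qed
    qed
  qed
qed

section \<open>The free product decomposition of the enlarged group\<close>

lemma front_transversal:
  obtains T where "T \<subseteq> front" "\<And>c. c \<in> front \<Longrightarrow> \<exists>t\<in>T. \<exists>m\<in>gen A. c = \<phi> m t"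
    "\<forall>t\<in>T. \<forall>t'\<in>T. \<forall>m\<in>gen A. t = \<phi> m t' \<longrightarrow> t = t'"
proof -
  note subA = gen_subgroup[OF apex_set(1)]
  define orb where "orb c = {\<phi> m c | m. m \<in> gen A}" for c
  \<comment> \<open>The choice depends only on the orbit as a set, so it is constant on
    orbits.\<close>
  define rep where "rep c = (SOME d. d \<in> orb c)" for c
  have orb_refl: "c \<in> orb c" for c
    unfolding orb_def using subgroup.one_closed[OF subA] act_one by force
  then have rep: "rep c \<in> orb c" for c unfolding rep_def by (rule someI)
  have orb_sub: "orb (\<phi> m c) \<subseteq> orb c" if m: "m \<in> gen A" for m c
  proof
    fix x assume "x \<in> orb (\<phi> m c)"
    then obtain k where k: "k \<in> gen A" "x = \<phi> k (\<phi> m c)" unfolding orb_def by blast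
    then have "x = \<phi> (k \<otimes> m) c" using m gen_A_carrier by (simp add: act_mult)
    then show "x \<in> orb c" unfolding orb_def using subgroup.m_closed[OF subA k(1) m] by blast
  qed
  have orb_eq: "orb (\<phi> m c) = orb c" if m: "m \<in> gen A" for m c
    using orb_sub[OF m, of c] orb_sub[OF subgroup.m_inv_closed[OF subA m], of "\<phi> m c"] m gen_A_carrier by auto
  have rep_eq: "rep (\<phi> m c) = rep c" if "m \<in> gen A" for m c
    unfolding rep_def using orb_eq[OF that] by simp
  have rep_act: "\<exists>m\<in>gen A. rep c = \<phi> m c" for c using rep[of c] unfolding orb_def by blast
  show ?thesis
  proof (rule that[of "rep ` front"])
    show "rep ` front \<subseteq> front" using rep_act front_act by (metis image_subsetI)
  next
    fix c assume c: "c \<in> front"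
    obtain m where m: "m \<in> gen A" "rep c = \<phi> m c" using rep_act by blast
    then have "c = \<phi> (inv m) (rep c)" using gen_A_carrier by simp
    then show "\<exists>t\<in>rep ` front. \<exists>m\<in>gen A. c = \<phi> m t" using c subgroup.m_inv_closed[OF subA m(1)] by blast
  next
    show "\<forall>t\<in>rep ` front. \<forall>t'\<in>rep ` front. \<forall>m\<in>gen A. t = \<phi> m t' \<longrightarrow> t = t'"
    proof (intro ballI impI)
      fix t t' m assume t: "t \<in> rep ` front" "t' \<in> rep ` front" "m \<in> gen A" "t = \<phi> m t'"
      have "rep t = t" if "t \<in> rep ` front" for t
        using that rep_act rep_eq by (metis imageE)
      then show "t = t'" using t rep_eq by metis
    qed
  qed
qed

text \<open>Letters from \<open>S\<close> are pushed to the right and conjugate the front letters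
  they pass, so a letter at t preceded by u turns into one at u t. A word with a letter in
  \<open>T\<close> thus becomes a nonempty front word times an element of \<open>gen A\<close>. Its
  initial part u is recorded to check that the next front letter does not merge.\<close>

lemma transversal_word:
  assumes T: "T \<subseteq> front" "\<forall>t\<in>T. \<forall>t'\<in>T. \<forall>m\<in>gen A. t = \<phi> m t' \<longrightarrow> t = t'"
    and "w \<in> reduced_words G (S \<union> T) R"
  shows "w \<in> reduced_words G S R \<or>
    (\<exists>u t x rest v m. w = u @ (t, x) # rest \<and> u \<in> reduced_words G S R \<and> t \<in> T \<and>
       v \<in> reduced_words G front R \<and> v \<noteq> [] \<and> fst (hd v) = \<phi> (word_value G u) t \<and>
       m \<in> gen A \<and> word_value G w = word_value G v \<otimes> m)"
  using assms(3)
proof (induction w)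
  case (Cons a w)
  note subA = gen_subgroup[OF apex_set(1)]
  obtain s x where a: "a = (s, x)" by force
  have s: "s \<in> S \<union> T" "x \<in> R s" "x \<noteq> \<one>" "w \<in> reduced_words G (S \<union> T) R" "w \<noteq> [] \<longrightarrow> fst (hd w) \<noteq> s"
    using Cons.prems a by (auto simp: reduced_words_Cons)
  have sC: "s \<in> C" using s T apex_set front_subset by blast
  have xc: "x \<in> carrier G" using R_carrier sC s by blast
  have S_gen: "word_value G u \<in> gen A" if "u \<in> reduced_words G S R" for u
    using word_value_in_generate[of u S R] that reduced_words_subset[of S R] A_gen unfolding gen_def by blast
  show ?case
  proof (cases "w \<in> reduced_words G S R")
    case True
    show ?thesis
    proof (cases "s \<in> S")
      case True
      then show ?thesis using \<open>w \<in> reduced_words G S R\<close> s a by (simp add: reduced_words_Cons)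
    next
      case False
      then have "s \<in> T" using s by blast
      then show ?thesis using s a xc T(1) S_gen[OF True]
        by (intro disjI2 exI[of _ "[]"] exI[of _ s] exI[of _ x] exI[of _ w] exI[of _ "[(s, x)]"] exI[of _ "word_value G w"])
          (auto simp: reduced_words_Cons)
    qed
  next
    case False
    then obtain u t y rest v m where w: "w = u @ (t, y) # rest" and u: "u \<in> reduced_words G S R"
      and t: "t \<in> T" and v: "v \<in> reduced_words G front R" "v \<noteq> []" "fst (hd v) = \<phi> (word_value G u) t"
      and m: "m \<in> gen A" and val: "word_value G w = word_value G v \<otimes> m"
      using Cons.IH s by blast
    note c = front_reduced_carrier[OF v(1)] gen_A_carrier[OF m] gen_A_carrier[OF S_gen[OF u]]
    show ?thesis
    proof (cases "s \<in> S")
      case True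
      have xA: "x \<in> gen A" using R_subset_gen[of s S] s True A_gen by blast
      let ?v = "map (\<lambda>(c, r). (\<phi> x c, x \<otimes> r \<otimes> inv x)) v"
      have v': "?v \<in> reduced_words G front R"
        using reduced_words_act[OF front_subset(1) xc _ v(1)] front_act xA by blast
      have "(s, x) # u \<in> reduced_words G S R"
        using s True u w by (cases u) (auto simp: reduced_words_Cons)
      moreover have "fst (hd ?v) = \<phi> (word_value G ((s, x) # u)) t"
        using v xc c by (cases v) (auto simp: act_mult)
      moreover have "word_value G (a # w) = word_value G ?v \<otimes> (x \<otimes> m)"
        using a val c xc word_value_act[OF front_subset(1) _ xc, of v] v(1) reduced_words_subset[of front R]
        by (auto simp: m_assoc)
      moreover have "x \<otimes> m \<in> gen A" using subgroup.m_closed[OF subA xA m] .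
      ultimately show ?thesis using a w t v v'
        by (intro disjI2 exI[of _ "(s, x) # u"] exI[of _ t] exI[of _ y] exI[of _ rest] exI[of _ ?v] exI[of _ "x \<otimes> m"])
          auto
    next
      case False
      then have sT: "s \<in> T" using s by blast
      \<comment> \<open>Equality would put s and t in one orbit, so s = t and u fixes t. Freeness
        outside \<open>A\<close> and the freeness of \<open>S\<close> then make u empty, and two
        neighbouring letters at s contradict reducedness.\<close>
      have "fst (hd v) \<noteq> s"
      proof
        assume "fst (hd v) = s"
        then have eq: "s = \<phi> (word_value G u) t" using v by simp
        then have st: "s = t" using T(2) sT t S_gen[OF u] by blast
        then have "word_value G u = \<one>"
          using gen_A_free_outside[OF S_gen[OF u], of t] eq t T(1) front_subset by auto
        then have "u = []" using S_free u by blast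
        then show False using s w st by simp
      qed
      then have "(s, x) # v \<in> reduced_words G front R"
        using v s sT T(1) by (auto simp: reduced_words_Cons)
      moreover have "word_value G (a # w) = word_value G ((s, x) # v) \<otimes> m"
        using a val c xc by (simp add: m_assoc)
      ultimately show ?thesis using a m sT
        by (intro disjI2 exI[of _ "[]"] exI[of _ s] exI[of _ x] exI[of _ w] exI[of _ "(s, x) # v"] exI[of _ m]) auto
    qed
  qed
qed simp

text \<open>The new factors are the rotation groups at one apex from each \<open>gen A\<close>-orbit
  in the front; the others are conjugates by \<open>gen A\<close>. A word that uses a new factor
  cannot have value one, since its nonempty front word would lie in \<open>gen A\<close>.\<close>

lemma windmill_extension:
  obtains A' S' where "windmill A' S'" "A \<subset> A'" "S \<subseteq> S'"
proof -
  obtain T where T: "T \<subseteq> front" "\<And>c. c \<in> front \<Longrightarrow> \<exists>t\<in>T. \<exists>m\<in>gen A. c = \<phi> m t"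
    "\<forall>t\<in>T. \<forall>t'\<in>T. \<forall>m\<in>gen A. t = \<phi> m t' \<longrightarrow> t = t'"
    by (rule front_transversal) blast
  have ST: "S \<union> T \<subseteq> A \<union> front" using T(1) apex_set by blast
  have subST: "subgroup (gen (S \<union> T)) G" using gen_subgroup ST union_subset by blast
  have A_ST: "gen A \<subseteq> gen (S \<union> T)" unfolding A_gen by (intro gen_mono) blast
  have "R c \<subseteq> gen (S \<union> T)" if c: "c \<in> A \<union> front" for c
  proof (cases "c \<in> A")
    case True
    then show ?thesis using R_subset_gen A_ST by blast
  next
    case False
    then obtain t m where t: "t \<in> T" "m \<in> gen A" "c = \<phi> m t" using T(2) c by blast
    have "R c = (\<lambda>r. m \<otimes> r \<otimes> inv m) ` R t"
      using R_act[of m t] t gen_A_carrier T(1) front_subset by blast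
    moreover have "R t \<subseteq> gen (S \<union> T)" using R_subset_gen t by blast
    moreover have "m \<in> gen (S \<union> T)" using t A_ST by blast
    ultimately show ?thesis
      using subgroup.m_closed[OF subST] subgroup.m_inv_closed[OF subST] by (auto simp: subset_iff)
  qed
  then have "gen (A \<union> front) \<subseteq> gen (S \<union> T)" using gen_minimal subST by blast
  then have gen_eq: "gen (A \<union> front) = gen (S \<union> T)" using gen_mono[OF ST] by blast
  have free: "w = []" if w: "w \<in> reduced_words G (S \<union> T) R" "word_value G w = \<one>" for w
  proof (rule ccontr)
    assume "w \<noteq> []"
    then have "w \<notin> reduced_words G S R" using S_free w by blast
    then obtain v m where v: "v \<in> reduced_words G front R" "v \<noteq> []" "m \<in> gen A" "word_value G w = word_value G v \<otimes> m"
      using transversal_word[OF T(1,3) w(1)] by blast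
    then have "word_value G v = inv m"
      using w(2) gen_A_carrier front_reduced_carrier by (metis inv_equality)
    then have "word_value G v \<in> gen A" using subgroup.m_inv_closed[OF gen_subgroup[OF apex_set(1)] v(3)] by simp
    then show False using front_word_notin_gen_A v by blast
  qed
  have "(\<exists>c\<in>hub. g \<in> R c) \<or> linear_growth g" if "g \<in> gen (A \<union> front)" for g
  proof -
    obtain w m where "w \<in> reduced_words G front R" "m \<in> gen A" "g = word_value G w \<otimes> m"
      using gen_union_decomposition[OF \<open>g \<in> gen (A \<union> front)\<close>] by blast
    then show ?thesis using hub_dichotomy_word by blast
  qed
  moreover have "S \<union> T \<subseteq> hub" using ST union_subset_hub by blast
  moreover have "hub \<noteq> {}" using apex_set union_subset_hub by blast
  ultimately have "windmill hub (S \<union> T)"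
    unfolding windmill_def gen_hub using hub_subset hub_act hub_far gen_eq free by blast
  moreover have "A \<subset> hub" using union_subset_hub front_nonempty front_subset by blast
  ultimately show ?thesis using that by blast
qed

end

section \<open>Exhausting all apices by Zorn's lemma\<close>

context rotating_group
begin

lemma windmill_singleton:
  assumes "c \<in> C"
  shows "windmill {c} {c}"
proof -
  have gen: "gen {c} \<subseteq> R c" using gen_minimal R_subgroup assms by blast
  have "w = []" if "w \<in> reduced_words G {c} R" "word_value G w = \<one>" for w
  proof (cases w)
    case (Cons a w')
    obtain d r where "a = (d, r)" by force
    then have a: "a = (c, r)" "r \<in> R c" "r \<noteq> \<one>" "w' \<in> reduced_words G {c} R" "w' \<noteq> [] \<longrightarrow> fst (hd w') \<noteq> c"
      using that Cons by (auto simp: reduced_words_Cons)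
    have "w' = []" using a by (cases w') (auto simp: reduced_words_Cons)
    moreover have "r \<in> carrier G" using a R_carrier assms by blast
    ultimately show ?thesis using a Cons that by simp
  qed simp
  moreover have "40 * \<delta> \<le> gromov_product c c c'" if "c' \<in> C - {c}" for c'
    using apex_dist[of c' c] that assms pos by simp
  ultimately show ?thesis unfolding windmill_def using assms gen R_fix by auto
qed

text \<open>An element involves only finitely many generators, and one member of the chain contains
  all their apices.\<close>

lemma gen_directed_Union:
  assumes "\<A> \<noteq> {}" "\<And>A B. A \<in> \<A> \<Longrightarrow> B \<in> \<A> \<Longrightarrow> A \<subseteq> B \<or> B \<subseteq> A" "g \<in> gen (\<Union>\<A>)"
  shows "\<exists>A\<in>\<A>. g \<in> gen A"
  using assms(3) unfolding gen_def[of "\<Union>\<A>"]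
proof induction
  case one
  then show ?case using assms(1) unfolding gen_def by (auto intro: generate.one)
next
  case (incl h)
  then show ?case unfolding gen_def by (auto intro: generate.incl)
next
  case (inv h)
  then show ?case unfolding gen_def by (auto intro: generate.inv)
next
  case (eng g h)
  then obtain A B where AB: "A \<in> \<A>" "B \<in> \<A>" "g \<in> gen A" "h \<in> gen B" by blast
  have "\<exists>D\<in>\<A>. A \<subseteq> D \<and> B \<subseteq> D" using assms(2)[OF AB(1,2)] AB by blast
  then obtain D where D: "D \<in> \<A>" "g \<in> gen D" "h \<in> gen D" using AB gen_mono by blast
  then show ?case unfolding gen_def by (auto intro: generate.eng)
qed

lemma reduced_words_directed_Union:
  assumes "\<A> \<noteq> {}" "\<And>A B. A \<in> \<A> \<Longrightarrow> B \<in> \<A> \<Longrightarrow> A \<subseteq> B \<or> B \<subseteq> A" "w \<in> reduced_words G (\<Union>\<A>) R"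
  shows "\<exists>A\<in>\<A>. w \<in> reduced_words G A R"
  using assms(3)
proof (induction w)
  case Nil
  then show ?case using assms(1) by auto
next
  case (Cons a w)
  then obtain A B where AB: "A \<in> \<A>" "B \<in> \<A>" "w \<in> reduced_words G A R" "fst a \<in> B"
    by (cases a) (auto simp: reduced_words_Cons)
  have "\<exists>D\<in>\<A>. A \<subseteq> D \<and> B \<subseteq> D" using assms(2)[OF AB(1,2)] AB by blast
  then obtain D where "D \<in> \<A>" "A \<subseteq> D" "B \<subseteq> D" by blast
  moreover from this have "w \<in> reduced_words G D R" using AB(3) by (auto simp: reduced_words_def)
  ultimately show ?case using Cons.prems AB(4) by (cases a) (auto simp: reduced_words_Cons)
qed

text \<open>A pair of sets is coded as one subset of a sum type, so that inclusion orders both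
  components at once. Every windmill condition involves only finitely many points of
  \<open>A\<close> and letters in \<open>S\<close>, hence passes to unions of chains; a maximal
  windmill that missed an apex could be extended.\<close>

lemma windmill_all_apices:
  assumes "C \<noteq> {}"
  obtains S where "windmill C S"
proof -
  define fstp sndp where "fstp Z = {a. Inl a \<in> Z}" and "sndp Z = {s. Inr s \<in> Z}" for Z :: "('x + 'x) set"
  define \<F> where "\<F> = {Z. windmill (fstp Z) (sndp Z)}"
  have parts: "fstp (A <+> S) = A" "sndp (A <+> S) = S" for A S :: "'x set"
    unfolding fstp_def sndp_def by auto
  obtain c where c: "c \<in> C" using assms by blast
  have "{c} <+> {c} \<in> \<F>" unfolding \<F>_def using windmill_singleton[OF c] by (simp only: mem_Collect_eq parts)
  then have ne: "\<F> \<noteq> {}" by blast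
  have chain: "\<Union>\<C> \<in> \<F>" if \<C>: "\<C> \<noteq> {}" "subset.chain \<F> \<C>" for \<C>
  proof -
    have wm: "windmill (fstp Z) (sndp Z)" if "Z \<in> \<C>" for Z
      using \<C>(2) that unfolding \<F>_def subset.chain_def by blast
    have lin: "Z \<subseteq> Z' \<or> Z' \<subseteq> Z" if "Z \<in> \<C>" "Z' \<in> \<C>" for Z Z'
      using \<C>(2) that unfolding subset.chain_def by blast
    have linA: "A \<subseteq> B \<or> B \<subseteq> A" if "A \<in> fstp ` \<C>" "B \<in> fstp ` \<C>" for A B
      using that lin unfolding fstp_def by blast
    have linS: "A \<subseteq> B \<or> B \<subseteq> A" if "A \<in> sndp ` \<C>" "B \<in> sndp ` \<C>" for A B
      using that lin unfolding sndp_def by blast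
    have nonempty: "fstp ` \<C> \<noteq> {}" "sndp ` \<C> \<noteq> {}" using \<C> by auto
    have un: "fstp (\<Union>\<C>) = \<Union>(fstp ` \<C>)" "sndp (\<Union>\<C>) = \<Union>(sndp ` \<C>)"
      unfolding fstp_def sndp_def by auto
    let ?A = "\<Union>(fstp ` \<C>)" and ?S = "\<Union>(sndp ` \<C>)"
    have gen_A: "\<exists>Z\<in>\<C>. g \<in> gen (fstp Z)" if "g \<in> gen ?A" for g
      using gen_directed_Union[OF nonempty(1) linA that] by blast
    have upper: "\<exists>Z\<in>\<C>. Z1 \<subseteq> Z \<and> Z2 \<subseteq> Z" if "Z1 \<in> \<C>" "Z2 \<in> \<C>" for Z1 Z2
      using lin[OF that] that by blast
    have fstp_mono: "fstp Z1 \<subseteq> fstp Z2" if "Z1 \<subseteq> Z2" for Z1 Z2 using that unfolding fstp_def by blast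
    have parts_Z: "fstp Z \<subseteq> C" "sndp Z \<subseteq> fstp Z" "fstp Z \<noteq> {}" if "Z \<in> \<C>" for Z
      using wm[OF that] unfolding windmill_def by auto
    have SA: "?S \<subseteq> ?A" using parts_Z(2) by blast
    have "windmill ?A ?S"
    proof (rule windmillI)
      show "?A \<subseteq> C" using parts_Z(1) by blast
      show "?S \<subseteq> ?A" using SA .
      show "?A \<noteq> {}" using parts_Z(3) \<C>(1) by auto
      show "\<phi> g a \<in> ?A" if g: "g \<in> gen ?A" and a: "a \<in> ?A" for g a
      proof -
        obtain Z1 where 1: "Z1 \<in> \<C>" "a \<in> fstp Z1" using a by blast
        obtain Z2 where 2: "Z2 \<in> \<C>" "g \<in> gen (fstp Z2)" using gen_A[OF g] by blast
        obtain Z where Z: "Z \<in> \<C>" "Z1 \<subseteq> Z" "Z2 \<subseteq> Z" using upper 1 2 by blast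
        have aZ: "a \<in> fstp Z" using 1(2) fstp_mono[OF Z(2)] by blast
        have gZ: "g \<in> gen (fstp Z)" using 2(2) gen_mono[OF fstp_mono[OF Z(3)]] by blast
        have "\<phi> g ` fstp Z \<subseteq> fstp Z" using wm[OF Z(1)] gZ unfolding windmill_def by simp
        then show ?thesis using Z(1) aZ by blast
      qed
      show "40 * \<delta> \<le> gromov_product a b c" if h: "c \<in> C - ?A" "a \<in> ?A" "b \<in> ?A" for a b c
      proof -
        obtain Z1 Z2 where 1: "Z1 \<in> \<C>" "a \<in> fstp Z1" "Z2 \<in> \<C>" "b \<in> fstp Z2" using h by blast
        obtain Z where Z: "Z \<in> \<C>" "Z1 \<subseteq> Z" "Z2 \<subseteq> Z" using upper 1 by blast
        have "a \<in> fstp Z" "b \<in> fstp Z" using 1 fstp_mono[OF Z(2)] fstp_mono[OF Z(3)] by auto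
        moreover have "c \<in> C - fstp Z" using h(1) Z(1) by blast
        ultimately show ?thesis using wm[OF Z(1)] unfolding windmill_def by simp
      qed
      show "gen ?A = gen ?S"
      proof
        show "gen ?S \<subseteq> gen ?A" using gen_mono[OF SA] .
        show "gen ?A \<subseteq> gen ?S"
        proof
          fix g assume "g \<in> gen ?A"
          then obtain Z where Z: "Z \<in> \<C>" "g \<in> gen (fstp Z)" using gen_A by blast
          then have "g \<in> gen (sndp Z)" using wm[OF Z(1)] unfolding windmill_def by simp
          moreover have "sndp Z \<subseteq> ?S" using Z by blast
          ultimately show "g \<in> gen ?S" using gen_mono by blast
        qed
      qed
      show "w = []" if w: "w \<in> reduced_words G ?S R" "word_value G w = \<one>" for w
      proof -
        obtain Z where Z: "Z \<in> \<C>" "w \<in> reduced_words G (sndp Z) R"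
          using reduced_words_directed_Union[OF nonempty(2) linS w(1)] by blast
        then show ?thesis using wm[OF Z(1)] w(2) unfolding windmill_def by simp
      qed
      show "(\<exists>c\<in>?A. g \<in> R c) \<or> linear_growth g" if g: "g \<in> gen ?A" for g
      proof -
        obtain Z where Z: "Z \<in> \<C>" "g \<in> gen (fstp Z)" using gen_A[OF g] by blast
        then have "(\<exists>c\<in>fstp Z. g \<in> R c) \<or> linear_growth g" using wm[OF Z(1)] unfolding windmill_def by simp
        then show ?thesis using Z(1) by blast
      qed
    qed
    then show ?thesis unfolding \<F>_def un[symmetric] by simp
  qed
  have "\<exists>M\<in>\<F>. \<forall>X\<in>\<F>. M \<subseteq> X \<longrightarrow> X = M"
    by (rule subset_Zorn_nonempty[OF ne chain])
  then obtain M where M: "M \<in> \<F>" "\<And>X. X \<in> \<F> \<Longrightarrow> M \<subseteq> X \<Longrightarrow> X = M"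
    by blast
  then have wm: "windmill (fstp M) (sndp M)" unfolding \<F>_def by simp
  have "fstp M = C"
  proof (rule ccontr)
    assume proper: "fstp M \<noteq> C"
    interpret proper_windmill G \<phi> \<delta> C R "fstp M" "sndp M"
      by unfold_locales (use wm proper in auto)
    obtain A' S' where ext: "windmill A' S'" "fstp M \<subset> A'" "sndp M \<subseteq> S'" by (rule windmill_extension)
    have "A' <+> S' \<in> \<F>" unfolding \<F>_def using ext(1) by (simp only: mem_Collect_eq parts)
    moreover have "M \<subseteq> A' <+> S'"
    proof
      fix z assume "z \<in> M"
      then show "z \<in> A' <+> S'" using ext(2,3) unfolding fstp_def sndp_def by (cases z) auto
    qed
    ultimately have "A' <+> S' = M" using M(2) by blast
    then show False using ext(2) parts(1)[of A' S'] by simp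
  qed
  then show ?thesis using that wm by simp
qed

section \<open>From the windmill of all apices to the normal closure\<close>

text \<open>The union of the rotation groups is invariant under conjugation, so it generates a
  normal subgroup. It contains \<open>H\<close>, the conjugate by the unit, and each rotation group
  lies in every normal subgroup containing \<open>H\<close>.\<close>

lemma normal_closure_eq_gen:
  assumes H: "subgroup H G" and RC: "R ` C = {conj_set G g H | g. g \<in> carrier G}"
  shows "normal_closure G H = gen C"
proof -
  have Hc: "h \<in> carrier G" if "h \<in> H" for h using subgroup.mem_carrier[OF H that] .
  have "conj_set G \<one> H = H" unfolding conj_set_eq using Hc by force
  then have "H \<in> R ` C" unfolding RC by force
  then have H_gen: "H \<subseteq> gen C" using R_subset_gen by auto
  have "g \<otimes> h \<otimes> inv g \<in> (\<Union>c\<in>C. R c)" if h: "h \<in> (\<Union>c\<in>C. R c)" and g: "g \<in> carrier G" for h g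
  proof -
    obtain c where c: "c \<in> C" "h \<in> R c" using h by blast
    then have "g \<otimes> h \<otimes> inv g \<in> R (\<phi> g c)" using R_act[OF g c(1)] by blast
    then show ?thesis using apex_act[OF g c(1)] by blast
  qed
  then have normal: "gen C \<lhd> G"
    unfolding gen_def using R_carrier by (intro normal_generateI) auto
  have least: "gen C \<subseteq> N" if N: "N \<lhd> G" "H \<subseteq> N" for N
  proof (rule gen_minimal)
    show "subgroup N G" using normal_imp_subgroup N(1) .
    fix c assume "c \<in> C"
    then obtain g where g: "g \<in> carrier G" "R c = conj_set G g H" using RC by blast
    then show "R c \<subseteq> N" unfolding conj_set_eq using normal.inv_op_closed2[OF N(1)] N(2) by auto
  qed
  show ?thesis
    unfolding normal_closure_def hull_def using normal least H_gen by blast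
qed

text \<open>A common nontrivial rotation would fix both apices.\<close>

lemma R_inj:
  assumes "c \<in> C" "c' \<in> C" "R c = R c'" "R c \<noteq> {\<one>}"
  shows "c = c'"
proof -
  obtain r where r: "r \<in> R c" "r \<noteq> \<one>"
    using assms(4) subgroup.one_closed[OF R_subgroup[OF assms(1)]] by blast
  have "\<phi> r c' = c'" using R_fix[OF assms(2)] r(1) assms(3) by simp
  then show ?thesis using rotation_fixes_one_apex[OF assms(1,2) r] by simp
qed

text \<open>The factors are indexed by apices and must be reindexed by group elements t with R s =
  t^-1 H t. For nontrivial \<open>H\<close> the choice of t is injective because apices are
  determined by their rotation groups. For trivial \<open>H\<close> the whole group is trivial and
  the empty family serves.\<close>

lemma free_product_of_conjugates:
  assumes H: "subgroup H G" and RC: "R ` C = {conj_set G g H | g. g \<in> carrier G}"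
    and S: "windmill C S"
  shows "\<exists>T\<subseteq>carrier G. is_free_product (G\<lparr>carrier := gen C\<rparr>) T (\<lambda>t. conj_set G (inv t) H)"
proof (cases "H = {\<one>}")
  case True
  have "conj_set G g H = {\<one>}" if "g \<in> carrier G" for g
    unfolding conj_set_eq True using that by simp
  then have "R c = {\<one>}" if "c \<in> C" for c using RC that by blast
  then have "gen C \<subseteq> {\<one>}" using gen_minimal[OF triv_subgroup, of C] by simp
  then have "gen C = generate G (\<Union>t\<in>{}. conj_set G (inv t) H)"
    unfolding gen_def using generate.one by (auto simp: generate_empty)
  moreover have "w = []" if "w \<in> reduced_words G {} (\<lambda>t. conj_set G (inv t) H)" for w
    using that by (cases w) (auto simp: reduced_words_def)
  ultimately have "is_free_product (G\<lparr>carrier := gen C\<rparr>) {} (\<lambda>t. conj_set G (inv t) H)"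
    by (intro is_free_productI) auto
  then show ?thesis by blast
next
  case False
  have SC: "S \<subseteq> C" and S_gen: "gen C = gen S"
    and S_free: "\<And>w. w \<in> reduced_words G S R \<Longrightarrow> word_value G w = \<one> \<Longrightarrow> w = []"
    using S unfolding windmill_def by auto
  have "\<forall>s\<in>S. \<exists>t\<in>carrier G. R s = conj_set G (inv t) H"
  proof
    fix s assume "s \<in> S"
    then obtain g where "g \<in> carrier G" "R s = conj_set G g H" using RC SC by blast
    then show "\<exists>t\<in>carrier G. R s = conj_set G (inv t) H" by (intro bexI[of _ "inv g"]) auto
  qed
  then obtain t where t: "\<And>s. s \<in> S \<Longrightarrow> t s \<in> carrier G" "\<And>s. s \<in> S \<Longrightarrow> R s = conj_set G (inv (t s)) H"
    by metis
  have nontriv: "R s \<noteq> {\<one>}" if s: "s \<in> S" for s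
  proof
    assume 1: "R s = {\<one>}"
    have "h = \<one>" if h: "h \<in> H" for h
    proof -
      have "inv (t s) \<otimes> h \<otimes> inv (inv (t s)) \<in> R s" using t(2)[OF s] h unfolding conj_set_eq by blast
      then show ?thesis
        using 1 conj_eq_one_iff[of "inv (t s)" h] t(1)[OF s] subgroup.mem_carrier[OF H h] by simp
    qed
    then show False using False subgroup.one_closed[OF H] by blast
  qed
  have inj: "inj_on t S"
  proof (rule inj_onI)
    fix s s' assume s: "s \<in> S" "s' \<in> S" "t s = t s'"
    then have "R s = R s'" using t(2) by metis
    then show "s = s'" using R_inj[of s s'] nontriv s SC by blast
  qed
  let ?K = "\<lambda>t. conj_set G (inv t) H"
  have K: "?K (t s) = R s" if "s \<in> S" for s using t(2)[OF that] by simp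
  define f where "f = inv_into S t"
  have f: "f u \<in> S" "R (f u) = ?K u" "t (f u) = u" if "u \<in> t ` S" for u
    using that inj K unfolding f_def by auto
  have sub: "subgroup (?K u) G" if "u \<in> t ` S" for u
    using f[OF that] R_subgroup SC by (metis subsetD)
  have triv: "w = []" if w: "w \<in> reduced_words G (t ` S) ?K" "word_value G w = \<one>" for w
  proof -
    let ?w = "map (\<lambda>(u, x). (f u, x)) w"
    have "?w \<in> reduced_words G S R"
      using w(1)
    proof (induction w)
      case (Cons a w)
      obtain u x where a: "a = (u, x)" by force
      have u: "u \<in> t ` S" "x \<in> ?K u" "x \<noteq> \<one>" "w \<in> reduced_words G (t ` S) ?K" "w \<noteq> [] \<longrightarrow> fst (hd w) \<noteq> u"
        using Cons.prems a by (auto simp: reduced_words_Cons)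
      have "f (fst (hd w)) \<noteq> f u" if "w \<noteq> []"
      proof -
        have "fst (hd w) \<in> t ` S" using u(4) that by (cases w) (auto simp: reduced_words_Cons)
        then show ?thesis using f(3) u(1,5) that by metis
      qed
      then show ?case using Cons.IH u a f[OF u(1)]
        by (cases w) (auto simp: reduced_words_Cons)
    qed simp
    moreover have "word_value G ?w = word_value G w"
      by (induction w) auto
    ultimately show ?thesis using S_free[of ?w] w(2) by simp
  qed
  have "(\<Union>u\<in>t ` S. ?K u) = (\<Union>s\<in>S. R s)" using K by auto
  then have "gen C = generate G (\<Union>u\<in>t ` S. ?K u)" using S_gen unfolding gen_def by simp
  then have "is_free_product (G\<lparr>carrier := gen C\<rparr>) (t ` S) ?K"
    using is_free_productI[of "t ` S" ?K "gen C"] sub triv by simp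
  moreover have "t ` S \<subseteq> carrier G" using t(1) by blast
  ultimately show ?thesis by blast
qed

end

theorem theorem2p14:
  fixes G :: "('g, 'b) monoid_scheme"
    and \<phi> :: "'g \<Rightarrow> 'x::metric_space \<Rightarrow> 'x"
    and \<alpha> :: real
    and H :: "'g set"
  assumes "group G"
    and "isometric_action G \<phi>"
    and "hyperbolic TYPE('x)"
    and "\<alpha> \<ge> 200"
    and "alpha_rotating G \<phi> \<alpha> H"
  shows "(\<exists>T \<subseteq> carrier G.
           is_free_product (G\<lparr>carrier := normal_closure G H\<rparr>) T
             (\<lambda>t. conj_set G (inv\<^bsub>G\<^esub> t) H)) \<and>
         (\<forall>h\<in>normal_closure G H.
           (\<exists>g\<in>carrier G. h \<in> conj_set G g H) \<or> loxodromic G \<phi> h)"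
proof -
  obtain \<delta> C R where H: "subgroup H G" and \<delta>: "\<delta> > 0" "delta_hyperbolic \<delta> TYPE('x)"
    and rot: "rotating_family G \<phi> C R" "separated (\<alpha> * \<delta>) C" "very_rotating G \<phi> \<delta> C R"
    and RC: "R ` C = {conj_set G g H | g. g \<in> carrier G}"
    using assms(5) unfolding alpha_rotating_def by blast
  \<comment> \<open>Separation for \<alpha> implies separation for the constant 200 fixed in the
    locale.\<close>
  have "200 * \<delta> \<le> \<alpha> * \<delta>" using assms(4) \<delta>(1) by (intro mult_right_mono) auto
  then have "separated (200 * \<delta>) C" using rot(2) unfolding separated_def by (meson order_trans)
  then interpret rotating_group G \<phi> \<delta> C R
    using assms(2) \<delta> rot unfolding rotating_group_def rotating_group_axioms_def by blast
  have "C \<noteq> {}" using RC one_closed by blast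
  then obtain S where S: "windmill C S" by (rule windmill_all_apices)
  have N: "normal_closure G H = gen C" using normal_closure_eq_gen[OF H RC] .
  have "(\<exists>g\<in>carrier G. h \<in> conj_set G g H) \<or> loxodromic G \<phi> h" if h: "h \<in> gen C" for h
  proof -
    have "(\<exists>c\<in>C. h \<in> R c) \<or> linear_growth h" using S h unfolding windmill_def by simp
    then show ?thesis
    proof
      assume "\<exists>c\<in>C. h \<in> R c"
      then show ?thesis using RC by blast
    next
      assume "linear_growth h"
      then show ?thesis using linear_growth_loxodromic gen_carrier[OF subset_refl h] by blast
    qed
  qed
  then show ?thesis using free_product_of_conjugates[OF H RC S] unfolding N by blast
qed

end
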